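(* For every pointed closed convex cone $K\subset\mathbb{E}$ with nonempty interior (with $\vartheta$-LHSCB $F$) and for every pair $(x,s)\in\operatorname{int}(K)\oplus\operatorname{int}(K^* )$, the sets $\mathcal{T}_0^2(x,s)$, $\mathcal{T}_1^2(x,s)$ and $\mathcal{T}_2^2(\eta;x,s)$ (for every $\eta\ge1$) are geodesically convex.
   Context: $\mathbb{E}$ is a finite-dimensional real vector space of dimension $n$ with dual $\mathbb{E}^*$ and pairing $\langle\cdot,\cdot\rangle$; $K^*:=\{s\in\mathbb{E}^*:\langle s,x\rangle\ge 0\ \forall x\in K\}$. A $\vartheta$-LHSCB for $K$ ($\vartheta\ge1$) is a $\mathcal{C}^3$ convex function $F:\operatorname{int}(K)\to\mathbb{R}$ such that $F\to+\infty$ along every sequence in $\operatorname{int}(K)$ converging to a boundary point of $K$, $F(tx)=F(x)-\vartheta\ln t$ for all $t>0$, and $|D^3F(x)[h,h,h]|\le 2(D^2F(x)[h,h])^{3/2}$ for all $x\in\operatorname{int}(K)$, $h\in\mathbb{E}$. The conjugate barrier is $F_*(s):=\sup\{-\langle s,x\rangle-F(x):x\in\operatorname{int}(K)\}$, a $\vartheta$-LHSCB for $K^*$. An inner product on $\mathbb{E}$ is fixed, so self-adjoint positive-definite maps $\mathbb{E}^*\to\mathbb{E}$ are identified with $\mathbb{S}^n_{++}$; $A\preceq B$ means $B-A$ is self-adjoint positive semidefinite. For $(x,s)\in\operatorname{int}(K)\oplus\operatorname{int}(K^* )$: $\mu:=\langle s,x\rangle/\vartheta$, $\tilde x:=-F_*'(s)$,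 $\tilde s:=-F'(x)$, $\tilde\mu:=\langle\tilde s,\tilde x\rangle/\vartheta$, and - $\mathcal{T}_0(x,s):=\{T\in\mathbb{S}^n_{++}:T^2(s)=x\}$; - $\mathcal{T}_1(x,s):=\{T\in\mathbb{S}^n_{++}:T^2(s)=x,\ T^2(\tilde s)=\tilde x\}$; - $\xi^*$ is the infimum of $\xi\ge1$ over all pairs $(T,\xi)$, $T\in\mathbb{S}^n$, $\xi\in\mathbb{R}$, with $T^2(s)=x$, $T^2(\tilde s)=\tilde x$ and $\frac{\mu}{\xi[\vartheta(\mu\tilde\mu-1)+1]}F_*''(s)\preceq T^2\preceq\frac{\xi[\vartheta(\mu\tilde\mu-1)+1]}{\mu}[F''(x)]^{-1}$; - for $\eta\ge1$, $\mathcal{T}_2(\eta;x,s)$ is the set of $T\in\mathbb{S}^n_{++}$ with $T^2(s)=x$, $T^2(\tilde s)=\tilde x$ and $\frac{\mu}{\eta\xi^*[\vartheta(\mu\tilde\mu-1)+1]}F_*''(s)\preceq T^2\preceq\frac{\eta\xi^*[\vartheta(\mu\tilde\mu-1)+1]}{\mu}[F''(x)]^{-1}$. $\mathcal{T}_0^2,\mathcal{T}_1^2,\mathcal{T}_2^2$ denote the sets of $T^2$ for $T$ in $\mathcal{T}_0,\mathcal{T}_1,\mathcal{T}_2$ respectively. A set $S\subset\mathbb{S}^n_{++}$ is geodesically convex if for all $A,B\in S$ and $t\in[0,1]$ the point $A^{1/2}(A^{-1/2}BA^{-1/2})^tA^{1/2}$ (on the geodesic joining $A$ and $B$ for the standard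 trace Riemannian metric on $\mathbb{S}^n_{++}$) lies in $S$. *)

theory Defs
  imports "HOL-Analysis.Analysis"
begin

text \<open>
  The space \<open>\<bbbE>\<close> is an arbitrary Euclidean space. Its dual is identified with \<open>\<bbbE>\<close> by means
  of the fixed inner product, so that the pairing \<open>\<langle>s, x\<rangle>\<close> is \<open>s \<bullet> x\<close>, first derivatives of
  real functions are gradients, and second derivatives are linear endomorphisms of \<open>\<bbbE>\<close>.
\<close>

section \<open>Self-adjoint operators and the geometric mean\<close>

definition self_adjoint :: "('a::euclidean_space \<Rightarrow> 'a) \<Rightarrow> bool" where
  "self_adjoint A \<longleftrightarrow> linear A \<and> (\<forall>u v. A u \<bullet> v = u \<bullet> A v)"

definition pos_def :: "('a::euclidean_space \<Rightarrow> 'a) \<Rightarrow> bool" where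
  "pos_def A \<longleftrightarrow> self_adjoint A \<and> (\<forall>v. v \<noteq> 0 \<longrightarrow> 0 < A v \<bullet> v)"

definition pos_semidef :: "('a::euclidean_space \<Rightarrow> 'a) \<Rightarrow> bool" where
  "pos_semidef A \<longleftrightarrow> self_adjoint A \<and> (\<forall>v. 0 \<le> A v \<bullet> v)"

definition loewner_le :: "('a::euclidean_space \<Rightarrow> 'a) \<Rightarrow> ('a \<Rightarrow> 'a) \<Rightarrow> bool"
    (infix \<open>\<preceq>\<close> 50) where
  "A \<preceq> B \<longleftrightarrow> pos_semidef (\<lambda>v. B v - A v)"

text \<open>
  Real powers of a positive definite operator through its spectral decomposition:
  \<open>A\<^sup>t = (\<Sum>\<lambda>. \<lambda>\<^sup>t P\<^sub>\<lambda>)\<close>, where \<open>\<lambda>\<close> runs over the eigenvalues of \<open>A\<close> and \<open>P\<^sub>\<lambda>\<close> is the orthogonal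
  projection onto the eigenspace, that is, the closest-point map of that subspace.
\<close>
definition op_powr :: "('a::euclidean_space \<Rightarrow> 'a) \<Rightarrow> real \<Rightarrow> 'a \<Rightarrow> 'a" where
  "op_powr A t v =
     (\<Sum>l | \<exists>u. u \<noteq> 0 \<and> A u = l *\<^sub>R u. (l powr t) *\<^sub>R closest_point {u. A u = l *\<^sub>R u} v)"

definition geodesic_point ::
    "('a::euclidean_space \<Rightarrow> 'a) \<Rightarrow> ('a \<Rightarrow> 'a) \<Rightarrow> real \<Rightarrow> 'a \<Rightarrow> 'a" where
  "geodesic_point A B t =
     op_powr A (1/2) \<circ> op_powr (op_powr A (-1/2) \<circ> B \<circ> op_powr A (-1/2)) t \<circ> op_powr A (1/2)"

definition geodesically_convex :: "('a::euclidean_space \<Rightarrow> 'a) set \<Rightarrow> bool" where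
  "geodesically_convex S \<longleftrightarrow>
     S \<subseteq> {A. pos_def A} \<and> (\<forall>A\<in>S. \<forall>B\<in>S. \<forall>t\<in>{0..1}. geodesic_point A B t \<in> S)"

section \<open>Derivatives\<close>

definition dderiv :: "('a::euclidean_space \<Rightarrow> real) \<Rightarrow> 'a \<Rightarrow> 'a \<Rightarrow> real" where
  "dderiv f h x = frechet_derivative f (at x) h"

text \<open>
  Intended for open \<open>S\<close>; in finite dimension, continuity of the highest derivative as a
  multilinear map is continuity of its value at each tuple of directions.
\<close>
primrec Ck_on :: "nat \<Rightarrow> 'a::euclidean_space set \<Rightarrow> ('a \<Rightarrow> real) \<Rightarrow> bool" where
  "Ck_on 0 S f \<longleftrightarrow> continuous_on S f"
| "Ck_on (Suc k) S f \<longleftrightarrow> (\<forall>x\<in>S. f differentiable (at x)) \<and> (\<forall>h. Ck_on k S (dderiv f h))"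

definition grad :: "('a::euclidean_space \<Rightarrow> real) \<Rightarrow> 'a \<Rightarrow> 'a" where
  "grad f x = (THE D. GDERIV f x :> D)"

definition hess :: "('a::euclidean_space \<Rightarrow> real) \<Rightarrow> 'a \<Rightarrow> 'a \<Rightarrow> 'a" where
  "hess f x = frechet_derivative (grad f) (at x)"

section \<open>Cones and self-concordant barriers\<close>

definition pointed :: "'a::euclidean_space set \<Rightarrow> bool" where
  "pointed K \<longleftrightarrow> (\<forall>x. x \<in> K \<and> - x \<in> K \<longrightarrow> x = 0)"

definition dual_cone :: "'a::euclidean_space set \<Rightarrow> 'a set" where
  "dual_cone K = {s. \<forall>x\<in>K. 0 \<le> s \<bullet> x}"

text \<open>Only the values of \<open>F\<close> on the interior of \<open>K\<close> are relevant.\<close>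
definition LHSCB :: "real \<Rightarrow> 'a::euclidean_space set \<Rightarrow> ('a \<Rightarrow> real) \<Rightarrow> bool" where
  "LHSCB \<theta> K F \<longleftrightarrow>
     1 \<le> \<theta> \<and>
     Ck_on 3 (interior K) F \<and>
     convex_on (interior K) F \<and>
     (\<forall>X y. (\<forall>k. X k \<in> interior K) \<and> X \<longlonglongrightarrow> y \<and> y \<in> frontier K
        \<longrightarrow> filterlim (\<lambda>k. F (X k)) at_top sequentially) \<and>
     (\<forall>x\<in>interior K. \<forall>t>0. F (t *\<^sub>R x) = F x - \<theta> * ln t) \<and>
     (\<forall>x\<in>interior K. \<forall>h.
        \<bar>dderiv (dderiv (dderiv F h) h) h x\<bar> \<le> 2 * (dderiv (dderiv F h) h x) powr (3/2))"

text \<open>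
  The supremum is finite for \<open>s\<close> in the interior of the dual cone, where the conjugate barrier
  lives; elsewhere the value is irrelevant.
\<close>
definition conj_barrier :: "'a::euclidean_space set \<Rightarrow> ('a \<Rightarrow> real) \<Rightarrow> 'a \<Rightarrow> real" where
  "conj_barrier K F s = (SUP x\<in>interior K. - (s \<bullet> x) - F x)"

section \<open>Primal-dual scalings\<close>

definition mu :: "real \<Rightarrow> 'a::euclidean_space \<Rightarrow> 'a \<Rightarrow> real" where
  "mu \<theta> x s = (s \<bullet> x) / \<theta>"

definition shadow_x :: "'a::euclidean_space set \<Rightarrow> ('a \<Rightarrow> real) \<Rightarrow> 'a \<Rightarrow> 'a" where
  "shadow_x K F s = - grad (conj_barrier K F) s"

definition shadow_s :: "('a::euclidean_space \<Rightarrow> real) \<Rightarrow> 'a \<Rightarrow> 'a" where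
  "shadow_s F x = - grad F x"

definition shadow_mu ::
    "real \<Rightarrow> 'a::euclidean_space set \<Rightarrow> ('a \<Rightarrow> real) \<Rightarrow> 'a \<Rightarrow> 'a \<Rightarrow> real" where
  "shadow_mu \<theta> K F x s = (shadow_s F x \<bullet> shadow_x K F s) / \<theta>"

definition T0 :: "'a::euclidean_space \<Rightarrow> 'a \<Rightarrow> ('a \<Rightarrow> 'a) set" where
  "T0 x s = {T. pos_def T \<and> (T \<circ> T) s = x}"

definition T1 ::
    "'a::euclidean_space set \<Rightarrow> ('a \<Rightarrow> real) \<Rightarrow> 'a \<Rightarrow> 'a \<Rightarrow> ('a \<Rightarrow> 'a) set" where
  "T1 K F x s =
     {T. pos_def T \<and> (T \<circ> T) s = x \<and> (T \<circ> T) (shadow_s F x) = shadow_x K F s}"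

definition hessian_bounds ::
    "real \<Rightarrow> 'a::euclidean_space set \<Rightarrow> ('a \<Rightarrow> real) \<Rightarrow> 'a \<Rightarrow> 'a \<Rightarrow> real \<Rightarrow> ('a \<Rightarrow> 'a) \<Rightarrow> bool" where
  "hessian_bounds \<theta> K F x s c Q \<longleftrightarrow>
     (let m = mu \<theta> x s; d = \<theta> * (m * shadow_mu \<theta> K F x s - 1) + 1 in
        (\<lambda>v. (m / (c * d)) *\<^sub>R hess (conj_barrier K F) s v) \<preceq> Q \<and>
        Q \<preceq> (\<lambda>v. (c * d / m) *\<^sub>R inv (hess F x) v))"

text \<open>
  Here \<open>T\<close> ranges over all self-adjoint operators, not only the positive definite ones.
  The infimum is that of a real set bounded below by \<open>1\<close>; for \<open>x\<close> and \<open>s\<close> in the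
  interiors of the cone and its dual, the set is nonempty.
\<close>
definition xi_star ::
    "real \<Rightarrow> 'a::euclidean_space set \<Rightarrow> ('a \<Rightarrow> real) \<Rightarrow> 'a \<Rightarrow> 'a \<Rightarrow> real" where
  "xi_star \<theta> K F x s =
     Inf {xi. 1 \<le> xi \<and> (\<exists>T. self_adjoint T \<and> (T \<circ> T) s = x \<and>
                (T \<circ> T) (shadow_s F x) = shadow_x K F s \<and>
                hessian_bounds \<theta> K F x s xi (T \<circ> T))}"

definition T2 ::
    "real \<Rightarrow> 'a::euclidean_space set \<Rightarrow> ('a \<Rightarrow> real) \<Rightarrow> real \<Rightarrow> 'a \<Rightarrow> 'a \<Rightarrow> ('a \<Rightarrow> 'a) set" where
  "T2 \<theta> K F \<eta> x s =
     {T. pos_def T \<and> (T \<circ> T) s = x \<and> (T \<circ> T) (shadow_s F x) = shadow_x K F s \<and>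
         hessian_bounds \<theta> K F x s (\<eta> * xi_star \<theta> K F x s) (T \<circ> T)}"

definition squares :: "('a \<Rightarrow> 'a) set \<Rightarrow> ('a \<Rightarrow> 'a) set" where
  "squares S = (\<lambda>T. T \<circ> T) ` S"

end

theory Submission
  imports Defs
begin

text \<open>
  Write \<open>M = A\<^sup>-\<^sup>1\<^sup>/\<^sup>2 B A\<^sup>-\<^sup>1\<^sup>/\<^sup>2\<close>. If \<open>A s = B s\<close>, then \<open>A\<^sup>1\<^sup>/\<^sup>2 s\<close> is fixed by \<open>M\<close>, hence by \<open>M\<^sup>t\<close>, and the
  point \<open>A\<^sup>1\<^sup>/\<^sup>2 M\<^sup>t A\<^sup>1\<^sup>/\<^sup>2\<close> of the geodesic also takes this value at \<open>s\<close>. The scalar inequality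
  \<open>l\<^sup>t \<le> (1 - t) + t l\<close> on the spectrum of \<open>M\<close> places the geodesic below the segment from \<open>A\<close> to
  \<open>B\<close>, which preserves upper bounds; applied to the inverses, it preserves positive semidefinite
  lower bounds. That the lower bound \<open>F\<^sub>*''(s)\<close> is positive semidefinite requires \<open>F\<^sub>*\<close> to be twice
  differentiable: \<open>F''\<close> is nondegenerate because a degenerate direction would make \<open>F\<close> affine along a
  line leaving the cone, and \<open>s\<close> is a value of \<open>- F'\<close> because \<open>\<langle>s, \<cdot>\<rangle> + F\<close> attains its minimum.
\<close>

section \<open>Spectral calculus of self-adjoint operators\<close>

lemma closest_point_subspace_eq:
  fixes S :: "'a::euclidean_space set"
  assumes S: "subspace S" and p: "p \<in> S" and orth: "\<And>z. z \<in> S \<Longrightarrow> (a - p) \<bullet> z = 0"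
  shows "closest_point S a = p"
proof -
  have "dist a p \<le> dist a z" if "z \<in> S" for z
  proof -
    have "(a - p) \<bullet> (p - z) = 0"
      using orth subspace_diff[OF S p that] by blast
    then have "(norm (a - z))\<^sup>2 = (norm (a - p))\<^sup>2 + (norm (p - z))\<^sup>2"
      by (simp add: power2_norm_eq_inner algebra_simps inner_commute)
    then have "(norm (a - p))\<^sup>2 \<le> (norm (a - z))\<^sup>2"
      by simp
    then show ?thesis
      unfolding dist_norm by (rule power2_le_imp_le) simp
  qed
  then show ?thesis
    using closest_point_unique[OF subspace_imp_convex[OF S] closed_subspace[OF S] p] by metis
qed

lemma closest_point_subspace:
  fixes S :: "'a::euclidean_space set"
  assumes S: "subspace S"
  shows "closest_point S a \<in> S" and "z \<in> S \<Longrightarrow> (a - closest_point S a) \<bullet> z = 0"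
proof -
  obtain y w where y: "y \<in> span S" and w: "\<And>z. z \<in> span S \<Longrightarrow> orthogonal w z" and a: "a = y + w"
    using orthogonal_subspace_decomp_exists[of S a] by blast
  have "span S = S"
    using S by (simp add: span_eq_iff)
  with y w a have *: "y \<in> S" "\<And>z. z \<in> S \<Longrightarrow> (a - y) \<bullet> z = 0"
    by (auto simp: orthogonal_def)
  have "closest_point S a = y"
    using closest_point_subspace_eq[OF S *] by blast
  with * show "closest_point S a \<in> S" "z \<in> S \<Longrightarrow> (a - closest_point S a) \<bullet> z = 0"
    by auto
qed

lemma linear_closest_point_subspace:
  fixes S :: "'a::euclidean_space set"
  assumes S: "subspace S"
  shows "linear (closest_point S)"
proof
  fix a b :: 'a and r :: real
  note cp = closest_point_subspace[OF S]
  show "closest_point S (a + b) = closest_point S a + closest_point S b"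
  proof (rule closest_point_subspace_eq[OF S])
    show "closest_point S a + closest_point S b \<in> S"
      by (intro subspace_add[OF S] cp)
    show "(a + b - (closest_point S a + closest_point S b)) \<bullet> z = 0" if "z \<in> S" for z
      using cp(2)[OF that, of a] cp(2)[OF that, of b] by (simp add: algebra_simps)
  qed
  show "closest_point S (r *\<^sub>R a) = r *\<^sub>R closest_point S a"
  proof (rule closest_point_subspace_eq[OF S])
    show "r *\<^sub>R closest_point S a \<in> S"
      by (intro subspace_scale[OF S] cp)
    show "(r *\<^sub>R a - r *\<^sub>R closest_point S a) \<bullet> z = 0" if "z \<in> S" for z
      using cp(2)[OF that, of a] by (simp add: algebra_simps)
  qed
qed

section \<open>Eigenvalues and functional calculus\<close>

definition eigenspace :: "('a::euclidean_space \<Rightarrow> 'a) \<Rightarrow> real \<Rightarrow> 'a set" where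
  "eigenspace A l = {u. A u = l *\<^sub>R u}"

definition eigvals :: "('a::euclidean_space \<Rightarrow> 'a) \<Rightarrow> real set" where
  "eigvals A = {l. \<exists>u. u \<noteq> 0 \<and> A u = l *\<^sub>R u}"

text \<open>The operator \<open>f(A)\<close> of the spectral theorem. Allowing every real function
  \<open>f\<close>, not only powers, lets affine functions of \<open>A\<close> be compared with its
  powers on the spectrum.\<close>

definition fcalc :: "('a::euclidean_space \<Rightarrow> 'a) \<Rightarrow> (real \<Rightarrow> real) \<Rightarrow> 'a \<Rightarrow> 'a" where
  "fcalc A f v = (\<Sum>l\<in>eigvals A. f l *\<^sub>R closest_point (eigenspace A l) v)"

lemma op_powr_fcalc: "op_powr A t = fcalc A (\<lambda>l. l powr t)"
  by (rule ext) (simp add: op_powr_def fcalc_def eigvals_def eigenspace_def)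

context
  fixes A :: "'a::euclidean_space \<Rightarrow> 'a"
  assumes sa: "self_adjoint A"
begin

private lemma linA: "linear A"
  using sa by (simp add: self_adjoint_def)

private lemma adjA: "A u \<bullet> v = u \<bullet> A v"
  using sa by (simp add: self_adjoint_def)

lemma subspace_eigenspace: "subspace (eigenspace A l)"
  using linA by (auto simp: eigenspace_def subspace_def linear_0 linear_add linear_scale algebra_simps)

lemma eigenspace_orthogonal:
  assumes "u \<in> eigenspace A l" "v \<in> eigenspace A k" "l \<noteq> k"
  shows "u \<bullet> v = 0"
  using adjA[of u v] assms by (simp add: eigenspace_def)

text \<open>Eigenvectors chosen for distinct eigenvalues are nonzero and pairwise orthogonal, hence
  independent. Finiteness matters because a sum over an infinite index set would be 0 by
  default.\<close>

lemma finite_eigvals: "finite (eigvals A)"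
proof -
  have "\<forall>l\<in>eigvals A. \<exists>u. u \<noteq> 0 \<and> A u = l *\<^sub>R u"
    by (simp add: eigvals_def)
  from bchoice[OF this] obtain e where e: "\<forall>l\<in>eigvals A. e l \<noteq> 0 \<and> A (e l) = l *\<^sub>R e l"
    by (rule exE)
  have orth: "e l \<bullet> e k = 0" if "l \<in> eigvals A" "k \<in> eigvals A" "l \<noteq> k" for l k
    using eigenspace_orthogonal[of "e l" l "e k" k] e that by (simp add: eigenspace_def)
  have inj: "inj_on e (eigvals A)"
    using orth e by (metis inj_onI inner_eq_zero_iff)
  have "pairwise orthogonal (e ` eigvals A)"
    unfolding pairwise_def orthogonal_def using orth by blast
  moreover have "0 \<notin> e ` eigvals A"
    using e by auto
  ultimately have "finite (e ` eigvals A)"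
    by (metis pairwise_orthogonal_independent independent_imp_finite)
  then show ?thesis
    using inj finite_imageD by blast
qed

text \<open>A maximiser of the Rayleigh quotient on an invariant subspace is an eigenvector.\<close>
lemma eigenvector_in_invariant_subspace:
  assumes W: "subspace W" and inv: "\<And>w. w \<in> W \<Longrightarrow> A w \<in> W" and "w0 \<in> W" "w0 \<noteq> 0"
  obtains u l where "u \<in> W" "u \<noteq> 0" "A u = l *\<^sub>R u"
proof -
  let ?S = "sphere 0 1 \<inter> W"
  have "compact ?S"
    by (intro compact_Int_closed compact_sphere closed_subspace W)
  moreover have "w0 /\<^sub>R norm w0 \<in> ?S"
    using assms by (simp add: subspace_scale[OF W])
  moreover have "continuous_on ?S (\<lambda>w. A w \<bullet> w)"
    using linear_continuous_on linear_conv_bounded_linear linA by (intro continuous_on_inner continuous_on_id) blast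
  ultimately obtain u where u: "u \<in> ?S" and umax: "\<And>w. w \<in> ?S \<Longrightarrow> A w \<bullet> w \<le> A u \<bullet> u"
    using continuous_attains_sup[of ?S "\<lambda>w. A w \<bullet> w"] by blast
  define l where "l = A u \<bullet> u"
  have uu: "u \<bullet> u = 1" and uW: "u \<in> W"
    using u by (auto simp: norm_eq_1)
  have le: "A w \<bullet> w \<le> l * (w \<bullet> w)" if "w \<in> W" for w
  proof (cases "w = 0")
    case True
    then show ?thesis by (simp add: linear_0[OF linA])
  next
    case False
    then have "A (w /\<^sub>R norm w) \<bullet> (w /\<^sub>R norm w) \<le> l"
      unfolding l_def by (intro umax) (simp add: subspace_scale[OF W that])
    moreover have "A (w /\<^sub>R norm w) \<bullet> (w /\<^sub>R norm w) = (A w \<bullet> w) / (norm w)\<^sup>2"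
      by (simp add: linear_scale[OF linA] power2_eq_square divide_inverse)
    ultimately show ?thesis
      using False by (simp add: power2_norm_eq_inner pos_divide_le_eq)
  qed
  define w where "w = A u - l *\<^sub>R u"
  have wW: "w \<in> W"
    unfolding w_def by (intro subspace_diff[OF W] subspace_scale[OF W] inv uW)
  \<comment> \<open>The Rayleigh bound at the perturbed point \<open>u + e *\<^sub>R w\<close>. The
    constant terms cancel and the first-order coefficient is \<open>2 * (w \<bullet> w)\<close>, so
    a small positive \<open>e\<close> forces \<open>w\<close> to vanish.\<close>
  have main: "2 * e * (w \<bullet> w) \<le> e\<^sup>2 * (l * (w \<bullet> w) - A w \<bullet> w)" for e :: real
  proof -
    have "A (u + e *\<^sub>R w) \<bullet> (u + e *\<^sub>R w) \<le> l * ((u + e *\<^sub>R w) \<bullet> (u + e *\<^sub>R w))"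
      by (intro le subspace_add[OF W] subspace_scale[OF W] uW wW)
    moreover have "A (u + e *\<^sub>R w) \<bullet> (u + e *\<^sub>R w) = l + 2 * e * (A u \<bullet> w) + e\<^sup>2 * (A w \<bullet> w)"
      using adjA[of w u] by (simp add: linear_add[OF linA] linear_scale[OF linA] inner_add_left
          inner_add_right l_def power2_eq_square inner_commute algebra_simps)
    moreover have "(u + e *\<^sub>R w) \<bullet> (u + e *\<^sub>R w) = 1 + 2 * e * (u \<bullet> w) + e\<^sup>2 * (w \<bullet> w)"
      using uu by (simp add: inner_add_left inner_add_right power2_eq_square inner_commute algebra_simps)
    moreover have "A u \<bullet> w = w \<bullet> w + l * (u \<bullet> w)"
      by (simp add: w_def inner_diff_left inner_diff_right algebra_simps inner_commute)
    ultimately have "l + 2 * e * (w \<bullet> w + l * (u \<bullet> w)) + e\<^sup>2 * (A w \<bullet> w)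
        \<le> l * (1 + 2 * e * (u \<bullet> w) + e\<^sup>2 * (w \<bullet> w))"
      by simp
    then show ?thesis
      by (simp add: algebra_simps)
  qed
  have "w \<bullet> w = 0"
  proof (rule ccontr)
    define c where "c = w \<bullet> w"
    define d where "d = \<bar>l * (w \<bullet> w) - A w \<bullet> w\<bar>"
    assume "w \<bullet> w \<noteq> 0"
    then have c: "c > 0" unfolding c_def by simp
    have d: "d \<ge> 0" unfolding d_def by simp
    have *: "2 * e * c \<le> e\<^sup>2 * d" for e
      using main[of e] mult_left_mono[of "l * (w \<bullet> w) - A w \<bullet> w" d "e\<^sup>2"]
      by (simp add: c_def d_def order_trans)
    \<comment> \<open>The step size \<open>e = c / (d + 1)\<close> keeps \<open>e * d\<close> below
      \<open>c\<close>, so the quadratic term cannot compensate the linear one; the summand 1 avoids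
      division by zero.\<close>
    have "2 * (c / (d + 1)) * c \<le> (c / (d + 1))\<^sup>2 * d"
      by (rule *)
    also have "\<dots> = (c / (d + 1)) * c * (d / (d + 1))"
      by (simp add: power2_eq_square)
    also have "\<dots> \<le> (c / (d + 1)) * c * 1"
      using c d by (intro mult_left_mono) auto
    finally have "c / (d + 1) * c \<le> 0" by simp
    moreover have "0 < c / (d + 1) * c"
      using c d by simp
    ultimately show False by simp
  qed
  then have "A u = l *\<^sub>R u"
    by (simp add: w_def)
  moreover have "u \<noteq> 0"
    using uu by auto
  ultimately show ?thesis
    using that uW by blast
qed

private lemma cp_in: "closest_point (eigenspace A l) v \<in> eigenspace A l"
  by (rule closest_point_subspace[OF subspace_eigenspace])

private lemma cp_inner:
  assumes "u \<in> eigenspace A l"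
  shows "u \<bullet> closest_point (eigenspace A l) v = u \<bullet> v"
  using closest_point_subspace(2)[OF subspace_eigenspace assms, of v]
  by (simp add: inner_diff_right inner_commute[of _ u])

text \<open>The residual is orthogonal to all eigenspaces. By self-adjointness their common
  orthogonal complement is invariant under \<open>A\<close>, so if it were nonzero it would contain
  an eigenvector, which would then be orthogonal to itself.\<close>

lemma sum_eigenprojections: "(\<Sum>l\<in>eigvals A. closest_point (eigenspace A l) v) = v"
proof (rule ccontr)
  define w where "w = v - (\<Sum>l\<in>eigvals A. closest_point (eigenspace A l) v)"
  assume "\<not> ?thesis"
  then have w0: "w \<noteq> 0" by (simp add: w_def)
  define W where "W = {w. \<forall>u k. u \<in> eigenspace A k \<longrightarrow> w \<bullet> u = 0}"
  have "w \<bullet> u = 0" if u: "u \<in> eigenspace A k" for u k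
  proof (cases "u = 0")
    case False
    then have k: "k \<in> eigvals A"
      using u by (auto simp: eigvals_def eigenspace_def)
    have "u \<bullet> (\<Sum>l\<in>eigvals A. closest_point (eigenspace A l) v)
        = (\<Sum>l\<in>eigvals A. if l = k then u \<bullet> v else 0)"
      unfolding inner_sum_right
      using cp_inner[OF u] eigenspace_orthogonal[OF u cp_in] by (intro sum.cong) auto
    also have "\<dots> = u \<bullet> v"
      using k finite_eigvals by simp
    finally show ?thesis
      by (simp add: w_def inner_diff_right inner_commute[of _ u])
  qed simp
  then have "w \<in> W" by (auto simp: W_def)
  moreover have "subspace W"
    by (auto simp: W_def subspace_def inner_add_left)
  moreover have "A y \<in> W" if "y \<in> W" for y
    using that adjA[of y] by (auto simp: W_def eigenspace_def)
  ultimately obtain u l where "u \<in> W" "u \<noteq> 0" "A u = l *\<^sub>R u"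
    using eigenvector_in_invariant_subspace w0 by metis
  then show False
    by (auto simp: W_def eigenspace_def)
qed

lemma linear_fcalc: "linear (fcalc A f)"
  unfolding fcalc_def
  by (intro linear_compose_sum ballI linear_compose_scale_right
      linear_closest_point_subspace subspace_eigenspace)

text \<open>Projections are idempotent and self-adjoint, so a copy can be moved to the left factor.
  The quadratic form of \<open>f(A)\<close> thus becomes a sum of squares weighted by
  \<open>f\<close>, from which symmetry and monotonicity in \<open>f\<close> are read off.\<close>

lemma inner_fcalc:
  "u \<bullet> fcalc A f v =
     (\<Sum>l\<in>eigvals A. f l * (closest_point (eigenspace A l) u \<bullet> closest_point (eigenspace A l) v))"
  unfolding fcalc_def inner_sum_right inner_scaleR_right
proof (intro sum.cong refl)
  fix l
  show "f l * (u \<bullet> closest_point (eigenspace A l) v)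
      = f l * (closest_point (eigenspace A l) u \<bullet> closest_point (eigenspace A l) v)"
    using cp_inner[OF cp_in[of l v], of u] by (simp add: inner_commute)
qed

lemma self_adjoint_fcalc: "self_adjoint (fcalc A f)"
  unfolding self_adjoint_def using linear_fcalc inner_fcalc
  by (simp add: inner_commute[of "fcalc A f _"]) (simp add: inner_commute)

lemma fcalc_mono:
  assumes "\<And>l. l \<in> eigvals A \<Longrightarrow> f l \<le> g l"
  shows "fcalc A f v \<bullet> v \<le> fcalc A g v \<bullet> v"
  unfolding inner_commute[of "fcalc A _ v"] inner_fcalc
  using assms by (intro sum_mono mult_right_mono) auto

lemma fcalc_cong:
  assumes "\<And>l. l \<in> eigvals A \<Longrightarrow> f l = g l"
  shows "fcalc A f = fcalc A g"
  using assms by (auto simp: fcalc_def fun_eq_iff)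

lemma fcalc_add: "fcalc A (\<lambda>l. f l + g l) v = fcalc A f v + fcalc A g v"
  by (simp add: fcalc_def algebra_simps sum.distrib)

lemma fcalc_scale: "fcalc A (\<lambda>l. c * f l) v = c *\<^sub>R fcalc A f v"
  by (simp add: fcalc_def scaleR_sum_right)

lemma fcalc_one: "fcalc A (\<lambda>l. 1) = id"
  by (simp add: fcalc_def sum_eigenprojections fun_eq_iff)

lemma fcalc_id: "fcalc A (\<lambda>l. l) = A"
proof
  fix v
  have "A v = A (\<Sum>l\<in>eigvals A. closest_point (eigenspace A l) v)"
    by (simp add: sum_eigenprojections)
  also have "\<dots> = fcalc A (\<lambda>l. l) v"
    unfolding fcalc_def linear_sum[OF linA] using cp_in by (intro sum.cong) (auto simp: eigenspace_def)
  finally show "fcalc A (\<lambda>l. l) v = A v" by simp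
qed

text \<open>Orthogonality of eigenspaces makes every projection other than the one for
  \<open>l\<close> annihilate \<open>u\<close>. This yields both multiplicativity of the calculus
  and the fact that fixed vectors of an operator stay fixed under its powers.\<close>

lemma fcalc_eigenvector:
  assumes u: "A u = l *\<^sub>R u"
  shows "fcalc A f u = f l *\<^sub>R u"
proof (cases "u = 0")
  case True
  then show ?thesis using linear_0[OF linear_fcalc] by simp
next
  case False
  then have l: "l \<in> eigvals A"
    using u by (auto simp: eigvals_def)
  have "closest_point (eigenspace A k) u = (if k = l then u else 0)" for k
    using u eigenspace_orthogonal[of u l]
    by (intro closest_point_subspace_eq[OF subspace_eigenspace])
       (auto simp: eigenspace_def linear_0[OF linA])
  then have "fcalc A f u = (\<Sum>k\<in>eigvals A. if k = l then f l *\<^sub>R u else 0)"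
    unfolding fcalc_def by (intro sum.cong) auto
  then show ?thesis
    using l finite_eigvals by simp
qed

lemma fcalc_compose: "fcalc A f (fcalc A g v) = fcalc A (\<lambda>l. f l * g l) v"
proof -
  have "fcalc A f (fcalc A g v) = (\<Sum>l\<in>eigvals A. g l *\<^sub>R fcalc A f (closest_point (eigenspace A l) v))"
    unfolding fcalc_def[of A g] by (simp add: linear_sum[OF linear_fcalc] linear_scale[OF linear_fcalc])
  also have "\<dots> = fcalc A (\<lambda>l. f l * g l) v"
    unfolding fcalc_def[of A "\<lambda>l. f l * g l"]
  proof (intro sum.cong refl)
    fix l
    have "A (closest_point (eigenspace A l) v) = l *\<^sub>R closest_point (eigenspace A l) v"
      using cp_in[of l v] by (simp add: eigenspace_def)
    from fcalc_eigenvector[OF this, of f]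
    show "g l *\<^sub>R fcalc A f (closest_point (eigenspace A l) v)
        = (f l * g l) *\<^sub>R closest_point (eigenspace A l) v" by simp
  qed
  finally show ?thesis .
qed

end

section \<open>Powers and geodesics of positive definite operators\<close>

lemma pos_def_self_adjoint: "pos_def A \<Longrightarrow> self_adjoint A"
  by (simp add: pos_def_def)

lemma self_adjoint_inner: "self_adjoint A \<Longrightarrow> A u \<bullet> v = u \<bullet> A v"
  by (simp add: self_adjoint_def)

lemma pos_def_eigvals:
  assumes "pos_def A" "l \<in> eigvals A"
  shows "0 < l"
proof -
  obtain u where u: "u \<noteq> 0" "A u = l *\<^sub>R u"
    using assms by (auto simp: eigvals_def)
  then have "0 < l * (u \<bullet> u)"
    using assms by (metis pos_def_def inner_scaleR_left)
  then show ?thesis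
    using u by (metis inner_gt_zero_iff zero_less_mult_pos2)
qed

lemma op_powr_add:
  assumes "pos_def A"
  shows "op_powr A a (op_powr A b v) = op_powr A (a + b) v"
  unfolding op_powr_fcalc fcalc_compose[OF pos_def_self_adjoint[OF assms]] by (simp add: powr_add)

lemma op_powr_1:
  assumes "pos_def A"
  shows "op_powr A 1 = A"
proof -
  note sa = pos_def_self_adjoint[OF assms]
  have "op_powr A 1 = fcalc A (\<lambda>l. l)"
    unfolding op_powr_fcalc 
    by (rule fcalc_cong[OF sa]) (simp add: pos_def_eigvals[OF assms] less_imp_le less_imp_neq[symmetric])
  then show ?thesis by (simp add: fcalc_id[OF sa])
qed

lemma op_powr_0:
  assumes "pos_def A"
  shows "op_powr A 0 = id"
proof -
  note sa = pos_def_self_adjoint[OF assms]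
  have "op_powr A 0 = fcalc A (\<lambda>l. 1)"
    unfolding op_powr_fcalc 
    \<comment> \<open>By convention \<open>0 powr 0\<close> is 0, so the eigenvalues must be known
      to be nonzero.\<close>
    by (rule fcalc_cong[OF sa]) (simp add: pos_def_eigvals[OF assms] less_imp_le less_imp_neq[symmetric])
  then show ?thesis by (simp add: fcalc_one[OF sa])
qed

lemma self_adjoint_op_powr:
  assumes "pos_def A"
  shows "self_adjoint (op_powr A t)"
  unfolding op_powr_fcalc by (rule self_adjoint_fcalc[OF pos_def_self_adjoint[OF assms]])

lemma linear_op_powr:
  assumes "pos_def A"
  shows "linear (op_powr A t)"
  using self_adjoint_op_powr[OF assms] by (simp add: self_adjoint_def)

lemma op_powr_minus_cancel:
  assumes "pos_def A"
  shows "op_powr A (- t) (op_powr A t v) = v"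
  by (simp add: op_powr_add[OF assms] op_powr_0[OF assms])

lemma op_powr_eigenvector:
  assumes "pos_def A" "A u = l *\<^sub>R u"
  shows "op_powr A t u = (l powr t) *\<^sub>R u"
  unfolding op_powr_fcalc by (rule fcalc_eigenvector[OF pos_def_self_adjoint[OF assms(1)] assms(2)])

text \<open>The quadratic form of the product at \<open>v\<close> is that of \<open>B\<close> at
  \<open>C v\<close>. This one fact serves squares, powers, the middle factor of the geodesic and
  the geodesic point itself.\<close>

lemma pos_def_congruence:
  assumes B: "pos_def B" and C: "self_adjoint C" and inj: "\<And>v. C v = 0 \<Longrightarrow> v = 0"
  shows "pos_def (C \<circ> B \<circ> C)"
  unfolding pos_def_def self_adjoint_def
proof (intro conjI allI impI)
  have lin: "linear B" "linear C"
    using B C by (auto simp: pos_def_def self_adjoint_def)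
  then show "linear (C \<circ> B \<circ> C)"
    by (intro linear_compose)
  have adj: "(C \<circ> B \<circ> C) u \<bullet> v = B (C u) \<bullet> C v" for u v
    using self_adjoint_inner[OF C] by simp
  show "(C \<circ> B \<circ> C) u \<bullet> v = u \<bullet> (C \<circ> B \<circ> C) v" for u v
    using adj[of u v] adj[of v u] self_adjoint_inner[OF pos_def_self_adjoint[OF B], of "C u" "C v"]
    by (simp add: inner_commute)
  show "0 < (C \<circ> B \<circ> C) v \<bullet> v" if "v \<noteq> 0" for v
    unfolding adj using B inj that by (auto simp: pos_def_def)
qed

lemma pos_def_id: "pos_def (id :: 'a::euclidean_space \<Rightarrow> 'a)"
  using linear_id by (auto simp: pos_def_def self_adjoint_def id_def)

lemma pos_def_compose_self:
  assumes "pos_def T"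
  shows "pos_def (T \<circ> T)"
proof -
  have "pos_def (T \<circ> id \<circ> T)"
    using assms by (intro pos_def_congruence pos_def_id) (force simp: pos_def_def)+
  then show ?thesis by simp
qed

lemma op_powr_eq_0:
  assumes "pos_def A" "op_powr A t v = 0"
  shows "v = 0"
  using op_powr_minus_cancel[OF assms(1), of t v] linear_0[OF linear_op_powr[OF assms(1)]] assms(2)
  by simp

lemma pos_def_op_powr:
  assumes "pos_def A"
  shows "pos_def (op_powr A t)"
proof -
  have "pos_def (op_powr A (t/2) \<circ> id \<circ> op_powr A (t/2))"
    using op_powr_eq_0[OF assms]
    by (intro pos_def_congruence pos_def_id self_adjoint_op_powr assms)
  then show ?thesis
    by (simp add: comp_def op_powr_add[OF assms] eta_contract_eq)
qed

lemma op_powr_half_compose: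
  assumes "pos_def A"
  shows "op_powr A (1/2) \<circ> op_powr A (1/2) = A"
  by (auto simp: fun_eq_iff op_powr_add[OF assms] op_powr_1[OF assms])

text \<open>Every positive definite \<open>Q\<close> is the square of its positive definite root, so
  a condition stated through \<open>T \<circ> T\<close> becomes a condition on \<open>Q\<close>
  alone and the factors \<open>T\<close> disappear from the problem.\<close>

lemma squares_pos_def:
  assumes "\<And>T. T \<in> S \<longleftrightarrow> pos_def T \<and> P (T \<circ> T)"
  shows "squares S = {Q. pos_def Q \<and> P Q}"
proof (intro set_eqI iffI)
  fix Q assume "Q \<in> squares S"
  then show "Q \<in> {Q. pos_def Q \<and> P Q}"
    using assms pos_def_compose_self by (auto simp: squares_def)
next
  fix Q assume "Q \<in> {Q. pos_def Q \<and> P Q}"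
  then have Q: "pos_def Q" "P Q" by auto
  have "op_powr Q (1/2) \<in> S"
    unfolding assms op_powr_half_compose[OF Q(1)] using Q pos_def_op_powr by blast
  then have "op_powr Q (1/2) \<circ> op_powr Q (1/2) \<in> squares S"
    by (simp add: squares_def)
  then show "Q \<in> squares S"
    by (simp only: op_powr_half_compose[OF Q(1)])
qed

text \<open>Convexity of the exponential between 0 and \<open>ln l\<close>.\<close>

lemma powr_le_affine:
  fixes l t :: real
  assumes "0 < l" "0 \<le> t" "t \<le> 1"
  shows "l powr t \<le> (1 - t) + t * l"
proof -
  have "convex_on UNIV (exp :: real \<Rightarrow> real)"
    by (rule exp_convex)
  from convex_onD[OF this, of t 0 "ln l"] show ?thesis
    using assms by (simp add: powr_def)
qed

section \<open>The geodesic between two positive definite operators\<close>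

context
  fixes A B :: "'a::euclidean_space \<Rightarrow> 'a" and t :: real
  assumes A: "pos_def A" and B: "pos_def B" and t: "0 \<le> t" "t \<le> 1"
begin

private definition "R = op_powr A (1/2)"
private definition "R' = op_powr A (- 1/2)"
private definition "M = R' \<circ> B \<circ> R'"

private lemma R_simps: "R (R v) = A v" "R' (R v) = v" "R (R' v) = v"
  unfolding R_def R'_def by (simp_all add: op_powr_add[OF A] op_powr_1[OF A] op_powr_0[OF A])

private lemma R_adj: "R u \<bullet> v = u \<bullet> R v" "R' u \<bullet> v = u \<bullet> R' v"
  unfolding R_def R'_def by (simp_all add: self_adjoint_inner[OF self_adjoint_op_powr[OF A]])

private lemma M_pos_def: "pos_def M"
  unfolding M_def R'_def
  using op_powr_eq_0[OF A] by (intro pos_def_congruence B self_adjoint_op_powr A)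

private lemma geod: "geodesic_point A B t = R \<circ> op_powr M t \<circ> R"
  by (simp add: geodesic_point_def R_def R'_def M_def)

lemma pos_def_geodesic_point: "pos_def (geodesic_point A B t)"
  unfolding geod unfolding R_def
  using op_powr_eq_0[OF A] by (intro pos_def_congruence pos_def_op_powr M_pos_def self_adjoint_op_powr A)

lemma geodesic_point_transport:
  assumes "A s = x" "B s = x"
  shows "geodesic_point A B t s = x"
proof -
  have "M (R s) = 1 *\<^sub>R R s"
    using assms R_simps by (simp add: M_def) metis
  from op_powr_eigenvector[OF M_pos_def this, of t] have "op_powr M t (R s) = R s"
    by simp
  then show ?thesis
    using assms R_simps by (simp add: geod)
qed

text \<open>The weighted arithmetic-geometric mean inequality for operators. The forms are evaluated
  at \<open>R v\<close>, where conjugation by \<open>R\<close> turns the identity into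
  \<open>A\<close> and \<open>M\<close> into \<open>B\<close>.\<close>

lemma geodesic_point_le_arith:
  "geodesic_point A B t v \<bullet> v \<le> (1 - t) * (A v \<bullet> v) + t * (B v \<bullet> v)"
proof -
  note sa = pos_def_self_adjoint[OF M_pos_def]
  have "geodesic_point A B t v \<bullet> v = fcalc M (\<lambda>l. l powr t) (R v) \<bullet> R v"
    by (simp add: geod R_adj op_powr_fcalc)
  also have "\<dots> \<le> fcalc M (\<lambda>l. (1 - t) * 1 + t * l) (R v) \<bullet> R v"
    using powr_le_affine[OF pos_def_eigvals[OF M_pos_def] t] by (intro fcalc_mono sa) simp
  also have "\<dots> = (1 - t) * (R v \<bullet> R v) + t * (M (R v) \<bullet> R v)"
    unfolding fcalc_add[OF sa] fcalc_scale[OF sa] fcalc_one[OF sa] fcalc_id[OF sa]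
    by (simp add: inner_add_left)
  also have "\<dots> = (1 - t) * (A v \<bullet> v) + t * (B v \<bullet> v)"
    by (simp add: R_adj(1)[symmetric] R_simps M_def)
  finally show ?thesis .
qed

text \<open>The dual form of the arithmetic bound for the inverses, which avoids inverting \<open>L\<close>.\<close>
lemma geodesic_point_ge:
  assumes L: "\<And>u v. L u \<bullet> v = u \<bullet> L v" "linear L" "\<And>v. 0 \<le> L v \<bullet> v"
    and LA: "\<And>v. L v \<bullet> v \<le> A v \<bullet> v" and LB: "\<And>v. L v \<bullet> v \<le> B v \<bullet> v"
  shows "L v \<bullet> v \<le> geodesic_point A B t v \<bullet> v"
proof -
  \<comment> \<open>For invertible \<open>C\<close> this is the quadratic form of
    \<open>L C\<^sup>-\<^sup>1 L \<preceq> L\<close>. It follows by expanding the nonnegative value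
    of \<open>L\<close> at \<open>v - z\<close> and bounding \<open>L z \<bullet> z\<close> by
    \<open>C z \<bullet> z = L v \<bullet> z\<close>.\<close>
  have dual: "L v \<bullet> z \<le> L v \<bullet> v" if "C z = L v" "\<And>v. L v \<bullet> v \<le> C v \<bullet> v" for C z
  proof -
    have "0 \<le> L (v - z) \<bullet> (v - z)"
      by (rule L(3))
    also have "\<dots> = L v \<bullet> v - 2 * (L v \<bullet> z) + L z \<bullet> z"
      using L(1)[of z v] by (simp add: linear_diff[OF L(2)] inner_diff_left inner_diff_right inner_commute)
    also have "\<dots> \<le> L v \<bullet> v - 2 * (L v \<bullet> z) + C z \<bullet> z"
      using that(2)[of z] by simp
    finally show ?thesis
      using that(1) by simp
  qed
  note sa = pos_def_self_adjoint[OF M_pos_def]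
  define w where "w = L v"
  define z where "z = R' w"
  have Rz: "R z = w" by (simp add: z_def R_simps)
  \<comment> \<open>The vectors \<open>a\<close> and \<open>b\<close> are the preimages of
    \<open>w\<close> under \<open>A\<close> and \<open>B\<close>. The forms of the two inverses at
    \<open>w\<close> then become \<open>z \<bullet> z\<close> and
    \<open>op_powr M (- 1) z \<bullet> z\<close>.\<close>
  define a where "a = R' z"
  have Aa: "A a = w"
    unfolding a_def using R_simps Rz by metis
  define b where "b = R' (op_powr M (- 1) z)"
  have Bb: "B b = w"
  proof -
    have "R' (B b) = M (op_powr M (- 1) z)"
      by (simp add: b_def M_def)
    also have "\<dots> = op_powr M 1 (op_powr M (- 1) z)"
      by (simp add: op_powr_1[OF M_pos_def])
    also have "\<dots> = z"
      by (simp add: op_powr_add[OF M_pos_def] op_powr_0[OF M_pos_def])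
    finally show ?thesis
      using R_simps Rz by metis
  qed
  \<comment> \<open>The scalar inequality at the reciprocal of each eigenvalue: the inverse of the
    geodesic point lies below the segment between the two inverses.\<close>
  have "op_powr M (- t) z \<bullet> z \<le> (1 - t) * (z \<bullet> z) + t * (op_powr M (- 1) z \<bullet> z)"
  proof -
    have "op_powr M (- t) z \<bullet> z \<le> fcalc M (\<lambda>l. (1 - t) * 1 + t * l powr (- 1)) z \<bullet> z"
      unfolding op_powr_fcalc
    proof (rule fcalc_mono[OF sa])
      fix l assume "l \<in> eigvals M"
      then have "0 < l" by (rule pos_def_eigvals[OF M_pos_def])
      then show "l powr (- t) \<le> (1 - t) * 1 + t * l powr (- 1)"
        using powr_le_affine[of "inverse l" t] t by (simp add: powr_minus powr_powr inverse_powr)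
    qed
    also have "\<dots> = (1 - t) * (z \<bullet> z) + t * (op_powr M (- 1) z \<bullet> z)"
      unfolding fcalc_add[OF sa] fcalc_scale[OF sa] fcalc_one[OF sa] op_powr_fcalc
      by (simp add: inner_add_left)
    finally show ?thesis .
  qed
  also have "z \<bullet> z = L v \<bullet> a"
    using R_adj by (simp add: a_def z_def w_def inner_commute)
  also have "op_powr M (- 1) z \<bullet> z = L v \<bullet> b"
    by (simp add: b_def z_def w_def R_adj[symmetric] inner_commute)
  also have "(1 - t) * (L v \<bullet> a) + t * (L v \<bullet> b) \<le> (1 - t) * (L v \<bullet> v) + t * (L v \<bullet> v)"
    using dual[of A a, OF _ LA] dual[of B b, OF _ LB] Aa Bb t
    by (intro add_mono mult_left_mono) (auto simp: w_def)
  finally have upper: "op_powr M (- t) z \<bullet> z \<le> L v \<bullet> v"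
    by (simp add: algebra_simps)
  \<comment> \<open>Completing the square: \<open>h \<bullet> h\<close> is the form of the geodesic
    point at \<open>v\<close>, minus twice \<open>L v \<bullet> v\<close>, plus the term just
    bounded by \<open>L v \<bullet> v\<close>.\<close>
  define h where "h = op_powr M (t/2) (R v) - op_powr M (- t/2) z"
  note adjM = self_adjoint_inner[OF self_adjoint_op_powr[OF M_pos_def]]
  have "0 \<le> h \<bullet> h" by simp
  also have "h \<bullet> h = op_powr M t (R v) \<bullet> R v - 2 * (R v \<bullet> z) + op_powr M (- t) z \<bullet> z"
  proof -
    have "op_powr M (t/2) (R v) \<bullet> op_powr M (t/2) (R v) = op_powr M t (R v) \<bullet> R v"
      using adjM[of "t/2" "op_powr M (t/2) (R v)" "R v"] by (simp add: op_powr_add[OF M_pos_def])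
    moreover have "op_powr M (- t/2) z \<bullet> op_powr M (- t/2) z = op_powr M (- t) z \<bullet> z"
      using adjM[of "- t/2" "op_powr M (- t/2) z" z] by (simp add: op_powr_add[OF M_pos_def])
    moreover have "op_powr M (t/2) (R v) \<bullet> op_powr M (- t/2) z = R v \<bullet> z"
      using adjM[of "t/2" "R v" "op_powr M (- t/2) z"]
      by (simp add: op_powr_add[OF M_pos_def] op_powr_0[OF M_pos_def])
    ultimately show ?thesis
      by (simp add: h_def inner_diff_left inner_diff_right inner_commute)
  qed
  also have "R v \<bullet> z = L v \<bullet> v"
    using R_adj(1)[of v z] by (simp add: Rz w_def inner_commute)
  also have "op_powr M t (R v) \<bullet> R v = geodesic_point A B t v \<bullet> v"
    by (simp add: geod R_adj)
  finally show ?thesis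
    using upper by simp
qed

end

section \<open>The Loewner order as a comparison of quadratic forms\<close>

lemma loewner_le_iff:
  assumes "self_adjoint Q"
  shows "L \<preceq> Q \<longleftrightarrow> self_adjoint L \<and> (\<forall>v. L v \<bullet> v \<le> Q v \<bullet> v)"
    and "Q \<preceq> L \<longleftrightarrow> self_adjoint L \<and> (\<forall>v. Q v \<bullet> v \<le> L v \<bullet> v)"
proof -
  have diff: "self_adjoint (\<lambda>v. C v - D v)" if "self_adjoint C" "self_adjoint D"
    for C D :: "'a \<Rightarrow> 'a"
    using that by (auto simp: self_adjoint_def linear_compose_sub inner_diff_left inner_diff_right)
  have neg: "self_adjoint (\<lambda>v. - C v)" if "self_adjoint C" for C :: "'a \<Rightarrow> 'a"
    using that linear_compose_neg by (auto simp: self_adjoint_def)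
  \<comment> \<open>Subtracting the difference from the self-adjoint \<open>Q\<close> recovers
    \<open>L\<close>, which gives the forward direction.\<close>
  have "self_adjoint (\<lambda>v. Q v - L v) \<longleftrightarrow> self_adjoint L"
    using diff[OF assms, of L] diff[OF assms, of "\<lambda>v. Q v - L v"] by auto
  then show "L \<preceq> Q \<longleftrightarrow> self_adjoint L \<and> (\<forall>v. L v \<bullet> v \<le> Q v \<bullet> v)"
    by (simp add: loewner_le_def pos_semidef_def inner_diff_left)
  have "self_adjoint (\<lambda>v. L v - Q v) \<longleftrightarrow> self_adjoint L"
    using diff[OF _ assms, of L] diff[OF assms neg, of "\<lambda>v. L v - Q v"] by auto
  then show "Q \<preceq> L \<longleftrightarrow> self_adjoint L \<and> (\<forall>v. Q v \<bullet> v \<le> L v \<bullet> v)"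
    by (simp add: loewner_le_def pos_semidef_def inner_diff_left)
qed

section \<open>Gradients, Hessians and restrictions to lines\<close>

lemma gderiv_imp_grad:
  assumes "GDERIV f x :> D"
  shows "grad f x = D"
  unfolding grad_def
proof (rule the_equality)
  show "GDERIV f x :> D" by (rule assms)
next
  fix D' assume "GDERIV f x :> D'"
  then have "(\<lambda>h. h \<bullet> D') = (\<lambda>h. h \<bullet> D)"
    using assms has_derivative_unique unfolding gderiv_def by blast
  then show "D' = D"
    by (metis vector_eq_ldot)
qed

text \<open>Riesz representation in the standard basis; it guarantees that the definite description
  in \<open>grad\<close> has a witness.\<close>

lemma has_derivative_grad:
  fixes f :: "'a::euclidean_space \<Rightarrow> real"
  assumes "f differentiable (at x)"
  shows "(f has_derivative (\<lambda>h. h \<bullet> grad f x)) (at x)"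
proof -
  obtain f' where f': "(f has_derivative f') (at x)"
    using assms by (auto simp: differentiable_def)
  then have lin: "linear f'"
    by (simp add: has_derivative_linear)
  have "f' = (\<lambda>h. h \<bullet> (\<Sum>b\<in>Basis. f' b *\<^sub>R b))"
  proof
    fix h
    have "f' h = f' (\<Sum>b\<in>Basis. (h \<bullet> b) *\<^sub>R b)"
      by (simp add: euclidean_representation)
    also have "\<dots> = h \<bullet> (\<Sum>b\<in>Basis. f' b *\<^sub>R b)"
      by (simp add: linear_sum[OF lin] linear_scale[OF lin] inner_sum_right mult.commute)
    finally show "f' h = h \<bullet> (\<Sum>b\<in>Basis. f' b *\<^sub>R b)" .
  qed
  then have "GDERIV f x :> (\<Sum>b\<in>Basis. f' b *\<^sub>R b)"
    using f' by (simp add: gderiv_def)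
  with gderiv_imp_grad[OF this] show ?thesis
    by (simp add: gderiv_def)
qed

lemma dderiv_eq:
  assumes "(f has_derivative f') (at x)"
  shows "dderiv f h x = f' h"
  using frechet_derivative_at[OF assms] by (simp add: dderiv_def)

lemma has_real_derivative_line:
  fixes f :: "'a::euclidean_space \<Rightarrow> real"
  assumes "f differentiable (at (y + r *\<^sub>R h))"
  shows "((\<lambda>r. f (y + r *\<^sub>R h)) has_real_derivative dderiv f h (y + r *\<^sub>R h)) (at r)"
proof -
  obtain f' where f': "(f has_derivative f') (at (y + r *\<^sub>R h))"
    using assms by (auto simp: differentiable_def)
  have "((\<lambda>r. y + r *\<^sub>R h) has_derivative (\<lambda>k. k *\<^sub>R h)) (at r)"
    by (auto intro!: derivative_eq_intros)
  from diff_chain_at[OF this f'] have "((\<lambda>r. f (y + r *\<^sub>R h)) has_derivative (\<lambda>k. f' (k *\<^sub>R h))) (at r)"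
    by (simp add: o_def)
  moreover have "(\<lambda>k. f' (k *\<^sub>R h)) = (*) (dderiv f h (y + r *\<^sub>R h))"
    using linear_scale[OF has_derivative_linear[OF f']] by (auto simp: dderiv_eq[OF f'])
  ultimately show ?thesis
    by (simp add: has_field_derivative_def)
qed

context
  fixes S :: "'a::euclidean_space set" and F :: "'a \<Rightarrow> real"
  assumes S: "open S" and C3: "Ck_on 3 S F"
begin

lemma differentiable_Ck3:
  assumes "x \<in> S"
  shows "F differentiable (at x)" "dderiv F h differentiable (at x)"
    "dderiv (dderiv F h) k differentiable (at x)"
  using C3 assms by (simp_all add: numeral_3_eq_3)

lemma dderiv_grad: "x \<in> S \<Longrightarrow> dderiv F h x = grad F x \<bullet> h"
  using dderiv_eq[OF has_derivative_grad[OF differentiable_Ck3(1)]] by (simp add: inner_commute)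

text \<open>\<open>Ck_on\<close> speaks only of scalar directional derivatives. On the open set
  these are the components of the gradient, and componentwise differentiability gives
  differentiability of the gradient as a map.\<close>

lemma has_derivative_hess:
  assumes x: "x \<in> S"
  shows "(grad F has_derivative hess F x) (at x)"
proof -
  have "(\<lambda>y. grad F y \<bullet> i) differentiable (at x)" for i
  proof -
    obtain f' where f': "(dderiv F i has_derivative f') (at x)"
      using differentiable_Ck3(2)[OF x] by (auto simp: differentiable_def)
    have "((\<lambda>y. grad F y \<bullet> i) has_derivative f') (at x)"
      by (rule has_derivative_transform_within_open[OF f' S x]) (rule dderiv_grad)
    then show ?thesis by (auto simp: differentiable_def)
  qed
  then have "grad F differentiable (at x)"
    using differentiable_componentwise_within[of "grad F" x UNIV] by blast
  then show ?thesis
    by (simp add: hess_def frechet_derivative_works)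
qed

lemma dderiv_hess:
  assumes x: "x \<in> S"
  shows "dderiv (dderiv F h) k x = hess F x k \<bullet> h"
proof -
  have "((\<lambda>y. grad F y \<bullet> h) has_derivative (\<lambda>k. hess F x k \<bullet> h)) (at x)"
    by (intro has_derivative_inner_left has_derivative_hess x)
  then have "(dderiv F h has_derivative (\<lambda>k. hess F x k \<bullet> h)) (at x)"
    by (rule has_derivative_transform_within_open[OF _ S x]) (simp add: dderiv_grad)
  from dderiv_eq[OF this] show ?thesis .
qed

lemma linear_hess: "x \<in> S \<Longrightarrow> linear (hess F x)"
  using has_derivative_hess has_derivative_linear by blast

lemma continuous_on_Ck3: "continuous_on S F" "continuous_on S (grad F)"
  using S differentiable_Ck3(1) has_derivative_hess
  by (auto simp: continuous_on_eq_continuous_at differentiable_imp_continuous_within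
      intro: has_derivative_continuous)

context
  fixes y h :: 'a and r :: real
  assumes yr: "y + r *\<^sub>R h \<in> S"
begin

lemma line_deriv1:
  "((\<lambda>r. F (y + r *\<^sub>R h)) has_real_derivative grad F (y + r *\<^sub>R h) \<bullet> h) (at r)"
  using has_real_derivative_line[OF differentiable_Ck3(1)[OF yr]] dderiv_grad[OF yr] by simp

private lemma open_line: "open {r. y + r *\<^sub>R h \<in> S}"
proof -
  have "open ((\<lambda>r. y + r *\<^sub>R h) -` S)"
    by (intro open_vimage S continuous_intros)
  then show ?thesis by (simp add: vimage_def)
qed

lemma line_deriv2:
  "((\<lambda>r. grad F (y + r *\<^sub>R h) \<bullet> h) has_real_derivative hess F (y + r *\<^sub>R h) h \<bullet> h) (at r)"
  using has_field_derivative_transform_within_open[OF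
      has_real_derivative_line[OF differentiable_Ck3(2)[OF yr]] open_line]
    dderiv_grad yr dderiv_hess[OF yr] by simp

lemma line_deriv3:
  "((\<lambda>r. hess F (y + r *\<^sub>R h) h \<bullet> h) has_real_derivative
     dderiv (dderiv (dderiv F h) h) h (y + r *\<^sub>R h)) (at r)"
  using has_field_derivative_transform_within_open[OF
      has_real_derivative_line[OF differentiable_Ck3(3)[OF yr]] open_line]
    dderiv_hess yr by simp

end

section \<open>First- and second-order consequences of convexity\<close>

context
  assumes conv: "convex_on S F"
begin

text \<open>Convexity bounds the difference quotients from \<open>y\<close> towards \<open>z\<close>
  by \<open>F z - F y\<close>; the bound survives the one-sided limit.\<close>

lemma grad_tangent:
  assumes y: "y \<in> S" and z: "z \<in> S"
  shows "F y + grad F y \<bullet> (z - y) \<le> F z"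
proof -
  have D: "((\<lambda>r. F (y + r *\<^sub>R (z - y))) has_real_derivative grad F y \<bullet> (z - y)) (at 0)"
    using line_deriv1[of y 0 "z - y"] y by simp
  then have "((\<lambda>r. (F (y + r *\<^sub>R (z - y)) - F y) / r) \<longlongrightarrow> grad F y \<bullet> (z - y)) (at_right 0)"
    by (simp add: DERIV_def filterlim_at_split)
  moreover have "\<forall>\<^sub>F r in at_right 0. (F (y + r *\<^sub>R (z - y)) - F y) / r \<le> F z - F y"
    using eventually_at_right_less[of 0] eventually_at_right_real[of 0 1, OF zero_less_one]
  proof eventually_elim
    case (elim r)
    have "F ((1 - r) *\<^sub>R y + r *\<^sub>R z) \<le> (1 - r) * F y + r * F z"
      using elim by (intro convex_onD[OF conv] y z) auto
    moreover have "(1 - r) *\<^sub>R y + r *\<^sub>R z = y + r *\<^sub>R (z - y)"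
      by (simp add: algebra_simps)
    ultimately show ?case
      using elim by (simp add: field_simps)
  qed
  ultimately have "grad F y \<bullet> (z - y) \<le> F z - F y"
    by (rule tendsto_upperbound) simp
  then show ?thesis by simp
qed

text \<open>Adding the tangent inequalities at two points shows that the gradient is monotone, so
  the difference quotients of its component along \<open>h\<close> are nonnegative.\<close>

lemma hess_nonneg:
  assumes y: "y \<in> S"
  shows "0 \<le> hess F y h \<bullet> h"
proof -
  obtain e where e: "e > 0" "ball y e \<subseteq> S"
    using S y open_contains_ball by blast
  have D: "((\<lambda>r. grad F (y + r *\<^sub>R h) \<bullet> h) has_real_derivative hess F y h \<bullet> h) (at 0)"
    using line_deriv2[of y 0 h] y by simp
  then have lim: "((\<lambda>r. (grad F (y + r *\<^sub>R h) \<bullet> h - grad F y \<bullet> h) / r) \<longlongrightarrow> hess F y h \<bullet> h) (at_right 0)"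
    by (simp add: DERIV_def filterlim_at_split)
  have pos: "0 < e / (norm h + 1)"
    using e by (simp add: add_nonneg_pos)
  have "\<forall>\<^sub>F r in at_right 0. 0 \<le> (grad F (y + r *\<^sub>R h) \<bullet> h - grad F y \<bullet> h) / r"
    using eventually_at_right_real[OF pos]
  proof eventually_elim
    case (elim r)
    then have r: "0 < r" "r * (norm h + 1) < e"
      by (auto simp: pos_less_divide_eq add_nonneg_pos)
    then have "r * norm h < e"
      by (simp add: algebra_simps)
    then have z: "y + r *\<^sub>R h \<in> S"
      using e r by (auto simp: dist_norm)
    have "0 \<le> r * (grad F (y + r *\<^sub>R h) \<bullet> h - grad F y \<bullet> h)"
      using grad_tangent[OF y z] grad_tangent[OF z y] by (simp add: algebra_simps)
    then show ?case
      using r by (simp add: zero_le_mult_iff)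
  qed
  then show ?thesis
    by (rule tendsto_lowerbound[OF lim]) simp
qed

end
end

section \<open>Nondegeneracy of the Hessian of a barrier\<close>

text \<open>Gronwall's argument: on a compact interval the hypothesis reads \<open>q' \<le> C q\<close>.\<close>
lemma zero_of_deriv_le_powr:
  fixes q q' :: "real \<Rightarrow> real"
  assumes "0 \<le> b" and q0: "q 0 = 0"
    and nonneg: "\<And>r. \<lbrakk>0 \<le> r; r \<le> b\<rbrakk> \<Longrightarrow> 0 \<le> q r"
    and deriv: "\<And>r. \<lbrakk>0 \<le> r; r \<le> b\<rbrakk> \<Longrightarrow> (q has_real_derivative q' r) (at r)"
    and bound: "\<And>r. \<lbrakk>0 \<le> r; r \<le> b\<rbrakk> \<Longrightarrow> q' r \<le> 2 * q r powr (3/2)"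
  shows "q b = 0"
proof -
  have "continuous_on {0..b} q"
    using deriv by (intro continuous_at_imp_continuous_on ballI DERIV_isCont) auto
  then have "\<exists>m\<in>{0..b}. \<forall>r\<in>{0..b}. q r \<le> q m"
    using \<open>0 \<le> b\<close> by (intro continuous_attains_sup) auto
  then obtain m where m: "\<And>r. r \<in> {0..b} \<Longrightarrow> q r \<le> q m"
    by blast
  \<comment> \<open>The power 3/2 splits as \<open>q r * sqrt (q r)\<close>, and the root is at most
    its value at the maximiser \<open>m\<close>.\<close>
  define C where "C = 2 * sqrt (q m)"
  have le: "q' r \<le> C * q r" if "0 \<le> r" "r \<le> b" for r
  proof -
    have "q r powr (3/2) = q r powr 1 * q r powr (1/2)"
      unfolding powr_add[symmetric] by simp
    also have "\<dots> = q r * sqrt (q r)"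
      using nonneg[OF that] by (simp add: powr_half_sqrt)
    also have "\<dots> \<le> q r * sqrt (q m)"
      using nonneg[OF that] m[of r] that by (intro mult_left_mono) auto
    finally show ?thesis
      using bound[OF that] by (simp add: C_def algebra_simps)
  qed
  \<comment> \<open>Multiplication by the integrating factor \<open>exp (- C * r)\<close> gives a
    nonincreasing function that starts at 0.\<close>
  have "q b * exp (- C * b) \<le> q 0 * exp (- C * 0)"
  proof (rule DERIV_nonpos_imp_nonincreasing[OF \<open>0 \<le> b\<close>])
    fix r assume r: "0 \<le> r" "r \<le> b"
    have "((\<lambda>r. q r * exp (- C * r)) has_real_derivative (q' r - C * q r) * exp (- C * r)) (at r)"
      by (auto intro!: derivative_eq_intros deriv r simp: algebra_simps)
    moreover have "(q' r - C * q r) * exp (- C * r) \<le> 0"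
      using le[OF r] by (simp add: mult_nonpos_nonneg)
    ultimately show "\<exists>y. ((\<lambda>r. q r * exp (- C * r)) has_real_derivative y) (at r) \<and> y \<le> 0"
      by blast
  qed
  then have "q b \<le> 0"
    using q0 by (simp add: mult_le_0_iff)
  then show ?thesis
    using nonneg[of b] \<open>0 \<le> b\<close> by simp
qed

text \<open>A sublevel set within \<open>C\<close> is closed: a limit of its points lies in
  \<open>K\<close>, and not on the frontier, because \<open>G\<close> would tend to infinity there.
  Hence it is compact and the usual extreme value argument applies.\<close>

lemma barrier_attains_min:
  fixes G :: "'a::euclidean_space \<Rightarrow> real"
  assumes "closed K" "compact C" and cont: "continuous_on (interior K) G"
    and barrier: "\<And>X y. \<lbrakk>\<And>k. X k \<in> interior K; X \<longlonglongrightarrow> y; y \<in> frontier K\<rbrakk>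
      \<Longrightarrow> filterlim (\<lambda>k. G (X k)) at_top sequentially"
    and x0: "x0 \<in> C \<inter> interior K"
  obtains y where "y \<in> C \<inter> interior K" "\<And>z. z \<in> C \<inter> interior K \<Longrightarrow> G y \<le> G z"
proof -
  define S where "S = {x \<in> C \<inter> interior K. G x \<le> G x0}"
  have "closed S"
    unfolding closed_sequential_limits
  proof (intro allI impI, elim conjE)
    fix X y assume X: "\<forall>k. X k \<in> S" and lim: "X \<longlonglongrightarrow> y"
    have XI: "X k \<in> interior K" and XC: "X k \<in> C" and XG: "G (X k) \<le> G x0" for k
      using X by (auto simp: S_def)
    have "y \<in> C"
      by (rule closed_sequentially[OF compact_imp_closed[OF \<open>compact C\<close>] XC lim])
    have "y \<in> K"
      by (rule closed_sequentially[OF \<open>closed K\<close> _ lim]) (use XI interior_subset in blast)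
    have "y \<in> interior K"
    proof (rule ccontr)
      assume "y \<notin> interior K"
      then have "y \<in> frontier K"
        using \<open>y \<in> K\<close> \<open>closed K\<close> by (simp add: frontier_def)
      from barrier[OF XI lim this] have "\<forall>\<^sub>F k in sequentially. G x0 < G (X k)"
        by (simp add: filterlim_at_top_dense)
      then obtain k where "G x0 < G (X k)"
        by (metis eventually_happens sequentially_bot)
      with XG[of k] show False by simp
    qed
    moreover from this have "(\<lambda>k. G (X k)) \<longlonglongrightarrow> G y"
      by (rule continuous_on_tendsto_compose[OF cont lim]) (simp add: XI)
    then have "G y \<le> G x0"
      by (rule LIMSEQ_le_const2) (use XG in blast)
    ultimately show "y \<in> S"
      using \<open>y \<in> C\<close> by (simp add: S_def)
  qed
  then have "compact (C \<inter> S)"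
    by (rule compact_Int_closed[OF \<open>compact C\<close>])
  moreover have "C \<inter> S = S"
    by (auto simp: S_def)
  ultimately have "compact S" by simp
  moreover have "x0 \<in> S"
    using x0 by (simp add: S_def)
  moreover have "continuous_on S G"
    by (rule continuous_on_subset[OF cont]) (auto simp: S_def)
  ultimately obtain y where y: "y \<in> S" "\<And>z. z \<in> S \<Longrightarrow> G y \<le> G z"
    using continuous_attains_inf[of S G] by blast
  have "G y \<le> G z" if "z \<in> C \<inter> interior K" for z
  proof (cases "G z \<le> G x0")
    case True
    then show ?thesis using y(2)[of z] that by (simp add: S_def)
  next
    case False
    then show ?thesis using y(2)[OF \<open>x0 \<in> S\<close>] by simp
  qed
  then show ?thesis
    using that y(1) by (auto simp: S_def)
qed

lemma interior_conic_scale: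
  fixes K :: "'a::euclidean_space set"
  assumes "conic K" "x \<in> interior K" "0 < c"
  shows "c *\<^sub>R x \<in> interior K"
proof -
  have "(*\<^sub>R) c ` interior K \<subseteq> interior K"
  proof (rule interior_maximal)
    show "(*\<^sub>R) c ` interior K \<subseteq> K"
      using assms interior_subset by (auto intro!: conicD)
    show "open ((*\<^sub>R) c ` interior K)"
      using assms by (intro open_scaling) auto
  qed
  then show ?thesis
    using assms(2) by blast
qed

text \<open>A small ball around \<open>s\<close> stays in the dual cone, so \<open>s\<close> may be
  pushed by length \<open>d\<close> against the direction of \<open>x\<close> and still pair
  nonnegatively with \<open>x\<close>. This supplies the coercivity of the linear term.\<close>

lemma interior_dual_cone_bound:
  fixes K :: "'a::euclidean_space set"
  assumes "s \<in> interior (dual_cone K)"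
  obtains e where "0 < e" "\<And>x. x \<in> K \<Longrightarrow> e * norm x \<le> s \<bullet> x"
proof -
  obtain d where d: "0 < d" "cball s d \<subseteq> dual_cone K"
    using assms by (meson mem_interior_cball)
  have "d * norm x \<le> s \<bullet> x" if "x \<in> K" for x
  proof (cases "x = 0")
    case False
    then have "s - (d / norm x) *\<^sub>R x \<in> cball s d"
      using d by (simp add: dist_norm)
    then have "0 \<le> (s - (d / norm x) *\<^sub>R x) \<bullet> x"
      using d(2) that unfolding dual_cone_def by blast
    also have "\<dots> = s \<bullet> x - d * norm x"
      using False by (simp add: inner_diff_left power2_norm_eq_inner[symmetric] power2_eq_square)
    finally show ?thesis by simp
  qed simp
  then show ?thesis
    using that d by blast
qed

context
  fixes K :: "'a::euclidean_space set" and F :: "'a \<Rightarrow> real" and \<theta> :: real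
  assumes cone: "convex_cone K" and cl: "closed K" and pt: "pointed K"
    and F: "LHSCB \<theta> K F"
begin

private lemma theta: "1 \<le> \<theta>"
  using F by (simp add: LHSCB_def)

private lemma C3: "Ck_on 3 (interior K) F"
  using F by (simp add: LHSCB_def)

private lemma conv: "convex_on (interior K) F"
  using F by (simp add: LHSCB_def)

private lemma barrier:
  "\<lbrakk>\<And>k. X k \<in> interior K; X \<longlonglongrightarrow> y; y \<in> frontier K\<rbrakk> \<Longrightarrow> filterlim (\<lambda>k. F (X k)) at_top sequentially"
  using F unfolding LHSCB_def by blast

private lemma log_homogeneous: "\<lbrakk>x \<in> interior K; 0 < t\<rbrakk> \<Longrightarrow> F (t *\<^sub>R x) = F x - \<theta> * ln t"
  using F unfolding LHSCB_def by blast

private lemma self_concordant: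
  "x \<in> interior K \<Longrightarrow>
    \<bar>dderiv (dderiv (dderiv F h) h) h x\<bar> \<le> 2 * (dderiv (dderiv F h) h x) powr (3/2)"
  using F unfolding LHSCB_def by blast

private lemma conicK: "conic K"
  using cone by (simp add: convex_cone_def)

private lemmas tangent = grad_tangent[OF open_interior C3 conv]
private lemmas lin_hess = linear_hess[OF open_interior C3]

text \<open>Scaling 0 by 2 leaves it in place, while logarithmic homogeneity would change the value
  of \<open>F\<close> by \<open>\<theta> * ln 2\<close>.\<close>

private lemma zero_notin_interior: "0 \<notin> interior K"
  using log_homogeneous[of 0 2] theta by auto

text \<open>
  Where \<open>D\<^sup>2F\<close> degenerates in direction \<open>h\<close>, self-concordance makes \<open>F\<close> affine along the
  line through \<open>h\<close>, so \<open>F\<close> stays bounded where this line leaves the cone.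
\<close>
private lemma degenerate_ray_in_cone:
  assumes y: "y \<in> interior K" and deg: "hess F y h \<bullet> h = 0" and "0 \<le> r"
  shows "y + r *\<^sub>R h \<in> interior K"
proof (rule ccontr)
  assume r: "y + r *\<^sub>R h \<notin> interior K"
  define J where "J = {0..} \<inter> (\<lambda>r. y + r *\<^sub>R h) -` (- interior K)"
  have "closed J"
    unfolding J_def by (intro closed_Int closed_atLeast closed_vimage continuous_intros) simp
  moreover have "r \<in> J"
    using r \<open>0 \<le> r\<close> by (simp add: J_def)
  moreover have bdd: "bdd_below J"
    by (rule bdd_belowI[of _ 0]) (simp add: J_def)
  ultimately have b: "Inf J \<in> J"
    by (intro closed_contains_Inf) auto
  \<comment> \<open>The first parameter at which the ray is outside the interior; closedness of
    \<open>J\<close> makes it attained.\<close>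
  define b where "b = Inf J"
  have b0: "0 \<le> b" and bI: "y + b *\<^sub>R h \<notin> interior K"
    using b by (auto simp: b_def J_def)
  have "b \<noteq> 0"
    using bI y by auto
  then have "0 < b" using b0 by simp
  have inI: "y + r *\<^sub>R h \<in> interior K" if "0 \<le> r" "r < b" for r
  proof (rule ccontr)
    assume "\<not> ?thesis"
    then have "r \<in> J" using that by (simp add: J_def)
    then have "b \<le> r" unfolding b_def using bdd by (rule cInf_lower)
    then show False using that by simp
  qed
  have zero: "hess F (y + r *\<^sub>R h) h \<bullet> h = 0" if r: "0 \<le> r" "r < b" for r
  proof (rule zero_of_deriv_le_powr[where q = "\<lambda>r. hess F (y + r *\<^sub>R h) h \<bullet> h"
        and q' = "\<lambda>r. dderiv (dderiv (dderiv F h) h) h (y + r *\<^sub>R h)"])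
    fix u assume "0 \<le> u" "u \<le> r"
    then have u: "y + u *\<^sub>R h \<in> interior K"
      using inI r by simp
    show "0 \<le> hess F (y + u *\<^sub>R h) h \<bullet> h"
      by (rule hess_nonneg[OF open_interior C3 conv u])
    show "((\<lambda>r. hess F (y + r *\<^sub>R h) h \<bullet> h) has_real_derivative
        dderiv (dderiv (dderiv F h) h) h (y + u *\<^sub>R h)) (at u)"
      by (rule line_deriv3[OF open_interior C3 u])
    show "dderiv (dderiv (dderiv F h) h) h (y + u *\<^sub>R h)
        \<le> 2 * (hess F (y + u *\<^sub>R h) h \<bullet> h) powr (3/2)"
      using self_concordant[OF u, of h] dderiv_hess[OF open_interior C3 u, of h h] by simp
  qed (use r deg in auto)
  \<comment> \<open>The slope along \<open>h\<close> cannot grow since the second derivative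
    vanishes. The tangent inequality is taken at the moving point and evaluated at \<open>y\<close>,
    which bounds \<open>F\<close> from above there.\<close>
  have bound: "F (y + r *\<^sub>R h) \<le> F y + b * \<bar>grad F y \<bullet> h\<bar>" if r: "0 \<le> r" "r < b" for r
  proof -
    have "grad F (y + r *\<^sub>R h) \<bullet> h \<le> grad F (y + 0 *\<^sub>R h) \<bullet> h"
    proof (rule DERIV_nonpos_imp_nonincreasing[OF r(1)])
      fix u assume "0 \<le> u" "u \<le> r"
      then have u: "0 \<le> u" "u < b" using r by auto
      show "\<exists>d. ((\<lambda>r. grad F (y + r *\<^sub>R h) \<bullet> h) has_real_derivative d) (at u) \<and> d \<le> 0"
        using line_deriv2[OF open_interior C3 inI[OF u]] zero[OF u] by auto
    qed
    then have "r * (grad F (y + r *\<^sub>R h) \<bullet> h) \<le> r * (grad F y \<bullet> h)"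
      using r by (simp add: mult_left_mono)
    also have "\<dots> \<le> r * \<bar>grad F y \<bullet> h\<bar>"
      using r by (intro mult_left_mono) auto
    also have "\<dots> \<le> b * \<bar>grad F y \<bullet> h\<bar>"
      using r by (intro mult_right_mono) auto
    finally show ?thesis
      using tangent[OF inI[OF r] y] by simp
  qed
  \<comment> \<open>These points approach the exit point along the ray from inside the cone,
    beginning at \<open>y\<close> itself.\<close>
  define X where "X k = y + (b - b / real (Suc k)) *\<^sub>R h" for k
  have X: "0 \<le> b - b / real (Suc k)" "b - b / real (Suc k) < b" for k
    using \<open>0 < b\<close> by (auto simp: field_simps)
  have lim: "X \<longlonglongrightarrow> y + b *\<^sub>R h"
  proof -
    have "(\<lambda>k. b * inverse (real (Suc k))) \<longlonglongrightarrow> b * 0"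
      by (intro tendsto_mult tendsto_const LIMSEQ_inverse_real_of_nat)
    then have "(\<lambda>k. y + (b - b * inverse (real (Suc k))) *\<^sub>R h) \<longlonglongrightarrow> y + (b - b * 0) *\<^sub>R h"
      by (intro tendsto_add tendsto_scaleR tendsto_diff tendsto_const)
    then show ?thesis
      by (simp add: X_def[abs_def] divide_inverse)
  qed
  have XI: "X k \<in> interior K" for k
    unfolding X_def by (rule inI[OF X])
  have "y + b *\<^sub>R h \<in> K"
    by (rule closed_sequentially[OF cl _ lim]) (use XI interior_subset in blast)
  then have "y + b *\<^sub>R h \<in> frontier K"
    using bI cl by (simp add: frontier_def)
  from barrier[OF XI lim this] have "\<forall>\<^sub>F k in sequentially. F y + b * \<bar>grad F y \<bullet> h\<bar> < F (X k)"
    by (simp add: filterlim_at_top_dense)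
  then obtain k where "F y + b * \<bar>grad F y \<bullet> h\<bar> < F (X k)"
    by (metis eventually_happens sequentially_bot)
  then show False
    using bound[OF X, of k] by (simp add: X_def)
qed

text \<open>A degenerate direction gives an infinite ray inside the cone. Dividing its points by
  their growing parameter shows that the direction itself lies in \<open>K\<close>. Degeneracy is
  invariant under sign, so the negative lies in \<open>K\<close> too, against pointedness.\<close>

lemma hess_barrier_pos:
  assumes y: "y \<in> interior K" and "h \<noteq> 0"
  shows "0 < hess F y h \<bullet> h"
proof (rule ccontr)
  assume "\<not> ?thesis"
  then have deg: "hess F y h \<bullet> h = 0"
    using hess_nonneg[OF open_interior C3 conv y, of h] by simp
  have K: "k \<in> K" if k: "hess F y k \<bullet> k = 0" for k
  proof (rule closed_sequentially[OF cl])
    show "inverse (real (Suc n)) *\<^sub>R (y + real (Suc n) *\<^sub>R k) \<in> K" for n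
      using degenerate_ray_in_cone[OF y k, of "real (Suc n)"] interior_subset
      by (intro conicD[OF conicK]) auto
    have "(\<lambda>n. inverse (real (Suc n)) *\<^sub>R y + k) \<longlonglongrightarrow> 0 *\<^sub>R y + k"
      by (intro tendsto_add tendsto_scaleR tendsto_const LIMSEQ_inverse_real_of_nat)
    then show "(\<lambda>n. inverse (real (Suc n)) *\<^sub>R (y + real (Suc n) *\<^sub>R k)) \<longlonglongrightarrow> k"
      by (simp add: scaleR_add_right del: of_nat_Suc)
  qed
  have "h \<in> K" "- h \<in> K"
    using K[of h] K[of "- h"] deg by (auto simp: linear_neg[OF lin_hess[OF y]])
  then show False
    using pt \<open>h \<noteq> 0\<close> by (simp add: pointed_def)
qed

private lemma bij_hess:
  assumes y: "y \<in> interior K"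
  shows "bij (hess F y)"
proof -
  have "inj (hess F y)"
    unfolding linear_injective_0[OF lin_hess[OF y]] using hess_barrier_pos[OF y] by force
  then show ?thesis
    using linear_injective_imp_surjective[OF lin_hess[OF y]] by (simp add: bij_def)
qed

text \<open>With \<open>v\<close> written as the Hessian applied to \<open>u\<close>, the form of
  the inverse at \<open>v\<close> is that of the Hessian at \<open>u\<close>.\<close>

lemma inv_hess_pos:
  assumes y: "y \<in> interior K" and "v \<noteq> 0"
  shows "0 < inv (hess F y) v \<bullet> v"
proof -
  have v: "hess F y (inv (hess F y) v) = v"
    by (simp add: bij_is_surj[OF bij_hess[OF y]] surj_f_inv_f)
  then have "inv (hess F y) v \<noteq> 0"
    using \<open>v \<noteq> 0\<close> linear_0[OF lin_hess[OF y]] by metis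
  from hess_barrier_pos[OF y this] show ?thesis
    by (simp add: v inner_commute)
qed

section \<open>Inverting the gradient map and differentiating the conjugate barrier\<close>

private lemma grad_injective: "inj_on (\<lambda>x. - grad F x) (interior K)"
proof (rule inj_onI, rule ccontr)
  fix y z assume y: "y \<in> interior K" and z: "z \<in> interior K"
    and eq: "- grad F y = - grad F z" and "y \<noteq> z"
  define h where "h = z - y"
  \<comment> \<open>Positive definiteness of the Hessian makes the slope strictly increasing along
    the segment, so the end gradients differ.\<close>
  have "grad F (y + 0 *\<^sub>R h) \<bullet> h < grad F (y + 1 *\<^sub>R h) \<bullet> h"
  proof (rule DERIV_pos_imp_increasing[where f = "\<lambda>r. grad F (y + r *\<^sub>R h) \<bullet> h"])
    fix r :: real assume r: "0 \<le> r" "r \<le> 1"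
    have "(1 - r) *\<^sub>R y + r *\<^sub>R z \<in> interior K"
      using convex_interior[of K] cone y z r by (intro convexD) (auto simp: convex_cone_def)
    then have "y + r *\<^sub>R h \<in> interior K"
      by (simp add: h_def algebra_simps)
    with line_deriv2[OF open_interior C3 this] hess_barrier_pos[OF this, of h] \<open>y \<noteq> z\<close>
    show "\<exists>d. ((\<lambda>r. grad F (y + r *\<^sub>R h) \<bullet> h) has_real_derivative d) (at r) \<and> 0 < d"
      by (auto simp: h_def)
  qed simp
  then show False
    using eq by (simp add: h_def)
qed

text \<open>The linear term grows at least like a multiple of the norm, whereas homogeneity lets
  \<open>F\<close> decrease only logarithmically from its minimum on the unit sphere. Minimising
  over a large ball therefore suffices.\<close>

private lemma minimiser_exists:
  assumes s: "s \<in> interior (dual_cone K)" and x0: "x0 \<in> interior K"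
  obtains y where "y \<in> interior K" "\<And>z. z \<in> interior K \<Longrightarrow> s \<bullet> y + F y \<le> s \<bullet> z + F z"
proof -
  define G where "G z = s \<bullet> z + F z" for z
  have contF: "continuous_on (interior K) F"
    by (rule continuous_on_Ck3[OF open_interior C3])
  obtain e where e: "0 < e" "\<And>x. x \<in> K \<Longrightarrow> e * norm x \<le> s \<bullet> x"
    using interior_dual_cone_bound[OF s] by blast
  have unit: "inverse (norm z) *\<^sub>R z \<in> sphere 0 1 \<inter> interior K" if "z \<in> interior K" for z
  proof -
    have "z \<noteq> 0" using that zero_notin_interior by auto
    then show ?thesis
      using interior_conic_scale[OF conicK that, of "inverse (norm z)"] by simp
  qed
  obtain u where u: "\<And>z. z \<in> sphere 0 1 \<inter> interior K \<Longrightarrow> F u \<le> F z"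
  proof (rule barrier_attains_min[OF cl compact_sphere contF _ unit[OF x0]])
    show "filterlim (\<lambda>k. F (X k)) at_top sequentially"
      if "\<And>k. X k \<in> interior K" "X \<longlonglongrightarrow> y" "y \<in> frontier K" for X y
      using that by (rule barrier)
  qed blast
  \<comment> \<open>The factor \<open>e / (2 * \<theta>)\<close> inside the logarithm is chosen so
    that \<open>ln r \<le> r - 1\<close> lets the logarithmic loss consume exactly half of the
    linear growth \<open>e * norm z\<close>.\<close>
  define c where "c = F u + \<theta> + \<theta> * ln (e / (2 * \<theta>))"
  have coercive: "e / 2 * norm z + c \<le> G z" if z: "z \<in> interior K" for z
  proof -
    have n: "0 < norm z"
      using z zero_notin_interior by auto
    have "F u \<le> F (inverse (norm z) *\<^sub>R z)"
      by (rule u[OF unit[OF z]])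
    also have "\<dots> = F z + \<theta> * ln (norm z)"
      using n by (simp add: log_homogeneous[OF z] ln_inverse)
    finally have 1: "F u - \<theta> * ln (norm z) \<le> F z" by simp
    have "ln (e / (2 * \<theta>) * norm z) \<le> e / (2 * \<theta>) * norm z - 1"
      using e n theta by (intro ln_le_minus_one) auto
    moreover have "ln (e / (2 * \<theta>) * norm z) = ln (e / (2 * \<theta>)) + ln (norm z)"
      using e(1) n theta by (intro ln_mult_pos) auto
    ultimately have "\<theta> * (ln (e / (2 * \<theta>)) + ln (norm z)) \<le> \<theta> * (e / (2 * \<theta>) * norm z - 1)"
      using theta by (intro mult_left_mono) auto
    also have "\<dots> = e / 2 * norm z - \<theta>"
      using theta by (simp add: field_simps)
    finally show ?thesis
      using 1 e(2)[of z] z interior_subset[of K] by (auto simp: G_def c_def algebra_simps)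
  qed
  \<comment> \<open>Beyond this radius the coercive bound exceeds \<open>G x0\<close>, and
    \<open>x0\<close> itself lies in the ball.\<close>
  define R where "R = max (norm x0) (2 * (G x0 - c) / e)"
  have "x0 \<in> cball 0 R \<inter> interior K"
    using x0 by (simp add: R_def)
  moreover have "continuous_on (interior K) G"
    unfolding G_def by (intro continuous_intros contF)
  moreover have "filterlim (\<lambda>k. G (X k)) at_top sequentially"
    if "\<And>k. X k \<in> interior K" "X \<longlonglongrightarrow> y" "y \<in> frontier K" for X y
    unfolding G_def
    by (rule filterlim_tendsto_add_at_top[OF tendsto_inner[OF tendsto_const that(2)] barrier[OF that]])
  ultimately obtain y where y: "y \<in> cball 0 R \<inter> interior K"
    and ymin: "\<And>z. z \<in> cball 0 R \<inter> interior K \<Longrightarrow> G y \<le> G z"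
    using barrier_attains_min[OF cl compact_cball] by metis
  have "G y \<le> G z" if z: "z \<in> interior K" for z
  proof (cases "norm z \<le> R")
    case True
    then show ?thesis using ymin z by simp
  next
    case False
    then have "2 * (G x0 - c) / e < norm z"
      by (simp add: R_def)
    then have "G x0 \<le> e / 2 * norm z + c"
      using e by (simp add: field_simps)
    then show ?thesis
      using coercive[OF z] ymin[of x0] x0 by (simp add: R_def)
  qed
  then show ?thesis
    using that[of y] y by (simp add: G_def)
qed

private lemma grad_surjective:
  assumes s: "s \<in> interior (dual_cone K)" and x0: "x0 \<in> interior K"
  obtains y where "y \<in> interior K" "- grad F y = s"
proof -
  obtain y where y: "y \<in> interior K" and ymin: "\<And>z. z \<in> interior K \<Longrightarrow> s \<bullet> y + F y \<le> s \<bullet> z + F z"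
    using minimiser_exists[OF assms] by blast
  have "((\<lambda>z. s \<bullet> z + F z) has_derivative (\<lambda>h. s \<bullet> h + h \<bullet> grad F y)) (at y)"
    by (auto intro!: derivative_eq_intros has_derivative_grad differentiable_Ck3(1)[OF open_interior C3 y])
  from differential_zero_maxmin[OF y open_interior this] ymin
  have "(\<lambda>h. s \<bullet> h + h \<bullet> grad F y) = (\<lambda>h. 0)"
    by blast
  then have "s \<bullet> h = (- grad F y) \<bullet> h" for h
    by (simp add: fun_eq_iff inner_commute add_eq_0_iff)
  then have "s = - grad F y"
    using vector_eq_rdot by blast
  then show ?thesis
    using that y by simp
qed

text \<open>The tangent inequality at \<open>y\<close> says that the defining supremum is attained
  at \<open>y\<close>. The second part is the Fenchel inequality at this slope, derived without a
  separate boundedness argument.\<close>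

private lemma conj_barrier_at_grad:
  assumes y: "y \<in> interior K"
  shows "conj_barrier K F (- grad F y) = grad F y \<bullet> y - F y"
    and "z \<in> interior K \<Longrightarrow> grad F y \<bullet> z - F z \<le> conj_barrier K F (- grad F y)"
proof -
  have le: "grad F y \<bullet> z - F z \<le> grad F y \<bullet> y - F y" if "z \<in> interior K" for z
    using tangent[OF y that] by (simp add: inner_diff_right)
  show *: "conj_barrier K F (- grad F y) = grad F y \<bullet> y - F y"
    unfolding conj_barrier_def by (rule cSup_eq_maximum) (use le y in auto)
  show "z \<in> interior K \<Longrightarrow> grad F y \<bullet> z - F z \<le> conj_barrier K F (- grad F y)"
    unfolding * by (rule le)
qed

text \<open>\<open>F\<^sub>*' = - (- F')\<^sup>-\<^sup>1\<close>, so \<open>F\<^sub>*''\<close> is the inverse of \<open>F''\<close> at the corresponding point.\<close>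
lemma hess_conj_barrier_nonneg:
  assumes s: "s \<in> interior (dual_cone K)" and x0: "x0 \<in> interior K"
  shows "0 \<le> hess (conj_barrier K F) s v \<bullet> v"
proof -
  define f where "f = (\<lambda>x. - grad F x)"
  define D where "D = f ` interior K"
  define g where "g = inv_into (interior K) f"
  define \<Phi> where "\<Phi> = conj_barrier K F"
  have inj: "inj_on f (interior K)"
    unfolding f_def by (rule grad_injective)
  have contf: "continuous_on (interior K) f"
    unfolding f_def by (intro continuous_on_minus continuous_on_Ck3[OF open_interior C3])
  have gf: "g (f x) = x" if "x \<in> interior K" for x
    unfolding g_def by (rule inv_into_f_f[OF inj that])
  \<comment> \<open>Invariance of domain. Openness is needed because differentiating
    \<open>grad \<Phi>\<close> at \<open>s\<close> requires its formula on a whole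
    neighbourhood.\<close>
  have openD: "open D"
    unfolding D_def by (rule invariance_of_domain[OF contf open_interior inj])
  have derg: "(g has_derivative (\<lambda>k. - inv (hess F y) k)) (at (f y))" if y: "y \<in> interior K" for y
  proof (rule has_derivative_inverse_strong[OF open_interior y contf gf])
    show "(f has_derivative (\<lambda>k. - hess F y k)) (at y)"
      unfolding f_def by (intro has_derivative_minus has_derivative_hess[OF open_interior C3 y])
    show "(\<lambda>k. - hess F y k) \<circ> (\<lambda>k. - inv (hess F y) k) = id"
      by (simp add: fun_eq_iff linear_neg[OF lin_hess[OF y]] surj_f_inv_f bij_is_surj[OF bij_hess[OF y]])
  qed
  have grad_\<Phi>: "grad \<Phi> t = - g t" if tD: "t \<in> D" for t
  proof -
    obtain y where y: "y \<in> interior K" and t: "t = f y"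
      using tD by (auto simp: D_def)
    obtain d where d: "0 < d" "ball t d \<subseteq> D"
      using openD tD open_contains_ball by blast
    have "GDERIV \<Phi> t :> - g t"
      unfolding gderiv_def
    proof (rule has_derivativeI_sandwich[OF d(1)])
      show "bounded_linear (\<lambda>h. h \<bullet> - g t)"
        by (intro bounded_linear_inner_left)
      have "isCont g t"
        unfolding t using has_derivative_continuous[OF derg[OF y]] .
      then have "((\<lambda>r. norm (g t - g r)) \<longlongrightarrow> norm (g t - g t)) (at t)"
        by (intro tendsto_intros) (simp add: isCont_def)
      then show "((\<lambda>r. norm (g t - g r)) \<longlongrightarrow> 0) (at t)"
        by simp
      fix r assume "r \<noteq> t" and r: "dist r t < d"
      then have "r \<in> D"
        using d by (auto simp: dist_commute)
      then obtain z where z: "z \<in> interior K" and rz: "r = f z"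
        by (auto simp: D_def)
      have *: "\<Phi> (f w) = - (f w \<bullet> w) - F w" if "w \<in> interior K" for w
        using conj_barrier_at_grad(1)[OF that] by (simp add: \<Phi>_def f_def)
      have **: "- (f w \<bullet> w') - F w' \<le> \<Phi> (f w)" if "w \<in> interior K" "w' \<in> interior K" for w w'
        using conj_barrier_at_grad(2)[OF that] by (simp add: \<Phi>_def f_def)
      \<comment> \<open>The Fenchel inequalities at \<open>t\<close> and at \<open>r\<close> enclose
        the remainder between 0 and \<open>(r - t) \<bullet> (g t - g r)\<close>. Continuity of
        \<open>g\<close> is then enough for differentiability of the conjugate.\<close>
      have "\<Phi> r - \<Phi> t - (r - t) \<bullet> - g t \<le> (r - t) \<bullet> (g t - g r)"
        using *[OF z] **[OF y z] by (simp add: t rz gf y z algebra_simps)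
      also have "\<dots> \<le> norm (r - t) * norm (g t - g r)"
        by (rule norm_cauchy_schwarz)
      finally have "\<Phi> r - \<Phi> t - (r - t) \<bullet> - g t \<le> norm (g t - g r) * norm (r - t)"
        by (simp add: mult.commute)
      moreover have "0 \<le> \<Phi> r - \<Phi> t - (r - t) \<bullet> - g t"
        using *[OF y] **[OF z y] by (simp add: t rz gf y z algebra_simps)
      ultimately show "norm (\<Phi> r - \<Phi> t - (r - t) \<bullet> - g t) / norm (r - t) \<le> norm (g t - g r)"
        using \<open>r \<noteq> t\<close> by (simp add: pos_divide_le_eq)
    qed
    then show ?thesis
      by (rule gderiv_imp_grad)
  qed
  obtain y where y: "y \<in> interior K" and fy: "f y = s"
    using grad_surjective[OF s x0] unfolding f_def by blast
  have "s \<in> D"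
    using y fy by (auto simp: D_def)
  have "((\<lambda>t. - g t) has_derivative (\<lambda>k. - (- inv (hess F y) k))) (at s)"
    by (intro has_derivative_minus derg[OF y, unfolded fy])
  then have "(grad \<Phi> has_derivative (\<lambda>k. - (- inv (hess F y) k))) (at s)"
    by (rule has_derivative_transform_within_open[OF _ openD \<open>s \<in> D\<close>]) (simp add: grad_\<Phi>)
  then have "hess \<Phi> s = inv (hess F y)"
    unfolding hess_def by (simp add: frechet_derivative_at[symmetric])
  then show ?thesis
    using inv_hess_pos[OF y, of v] by (cases "v = 0") (auto simp: \<Phi>_def)
qed

end

section \<open>Geodesic convexity\<close>

lemma geodesically_convexI:
  assumes "\<And>A B t. \<lbrakk>pos_def A; pos_def B; P A; P B; 0 \<le> t; t \<le> 1\<rbrakk> \<Longrightarrow> P (geodesic_point A B t)"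
  shows "geodesically_convex {Q. pos_def Q \<and> P Q}"
  unfolding geodesically_convex_def using assms pos_def_geodesic_point by auto

context
  fixes A B L :: "'a::euclidean_space \<Rightarrow> 'a" and t :: real
  assumes AB: "pos_def A" "pos_def B" and t: "0 \<le> t" "t \<le> 1"
begin

private lemma sa: "self_adjoint A" "self_adjoint B" "self_adjoint (geodesic_point A B t)"
  using AB pos_def_geodesic_point[OF AB t] by (simp_all add: pos_def_self_adjoint)

lemma geodesic_point_loewner_upper:
  assumes "A \<preceq> L" "B \<preceq> L"
  shows "geodesic_point A B t \<preceq> L"
  unfolding loewner_le_iff(2)[OF sa(3)]
proof (intro conjI allI)
  show "self_adjoint L"
    using assms by (simp add: loewner_le_iff(2)[OF sa(1)])
  fix v
  have "geodesic_point A B t v \<bullet> v \<le> (1 - t) * (A v \<bullet> v) + t * (B v \<bullet> v)"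
    by (rule geodesic_point_le_arith[OF AB t])
  also have "\<dots> \<le> (1 - t) * (L v \<bullet> v) + t * (L v \<bullet> v)"
    using assms t by (intro add_mono mult_left_mono)
      (auto simp: loewner_le_iff(2)[OF sa(1)] loewner_le_iff(2)[OF sa(2)])
  finally show "geodesic_point A B t v \<bullet> v \<le> L v \<bullet> v"
    by (simp add: algebra_simps)
qed

lemma geodesic_point_loewner_lower:
  assumes "L \<preceq> A" "L \<preceq> B" and "\<And>v. 0 \<le> L v \<bullet> v"
  shows "L \<preceq> geodesic_point A B t"
  unfolding loewner_le_iff(1)[OF sa(3)]
proof (intro conjI allI)
  show L: "self_adjoint L"
    using assms by (simp add: loewner_le_iff(1)[OF sa(1)])
  show "L v \<bullet> v \<le> geodesic_point A B t v \<bullet> v" for v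
    using assms L by (intro geodesic_point_ge[OF AB t])
      (auto simp: loewner_le_iff(1)[OF sa(1)] loewner_le_iff(1)[OF sa(2)] self_adjoint_def)
qed

end

theorem corollary5p2:
  fixes K :: "'a::euclidean_space set" and F :: "'a \<Rightarrow> real" and \<theta> :: real and x s :: 'a
  assumes "convex_cone K" and "closed K" and "pointed K" and "interior K \<noteq> {}"
    and "LHSCB \<theta> K F"
    and "x \<in> interior K" and "s \<in> interior (dual_cone K)"
  shows "geodesically_convex (squares (T0 x s)) \<and>
         geodesically_convex (squares (T1 K F x s)) \<and>
         (\<forall>\<eta>\<ge>1. geodesically_convex (squares (T2 \<theta> K F \<eta> x s)))"
proof (intro conjI allI impI)
  let ?P1 = "\<lambda>Q. Q s = x \<and> Q (shadow_s F x) = shadow_x K F s"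
  have "squares (T0 x s) = {Q. pos_def Q \<and> Q s = x}"
    by (rule squares_pos_def) (simp add: T0_def)
  moreover have "geodesically_convex {Q. pos_def Q \<and> Q s = x}"
    by (intro geodesically_convexI geodesic_point_transport)
  ultimately show "geodesically_convex (squares (T0 x s))"
    by simp
  have "squares (T1 K F x s) = {Q. pos_def Q \<and> ?P1 Q}"
    by (rule squares_pos_def) (simp add: T1_def)
  moreover have "geodesically_convex {Q. pos_def Q \<and> ?P1 Q}"
    by (intro geodesically_convexI conjI geodesic_point_transport) auto
  ultimately show "geodesically_convex (squares (T1 K F x s))"
    by simp
  fix \<eta> :: real
  define c where "c = \<eta> * xi_star \<theta> K F x s"
  \<comment> \<open>One number carries both bounds: the coefficient of the lower bound is
    \<open>inverse k\<close>, even where a denominator vanishes, since division by zero gives 0.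
    Only the sign of \<open>k\<close> matters below.\<close>
  define k where "k = c * (\<theta> * (mu \<theta> x s * shadow_mu \<theta> K F x s - 1) + 1) / mu \<theta> x s"
  define L where "L = (\<lambda>v. inverse k *\<^sub>R hess (conj_barrier K F) s v)"
  define U where "U = (\<lambda>v. k *\<^sub>R inv (hess F x) v)"
  have bounds: "hessian_bounds \<theta> K F x s c Q \<longleftrightarrow> L \<preceq> Q \<and> Q \<preceq> U" for Q
    by (simp add: hessian_bounds_def Let_def L_def U_def k_def inverse_eq_divide)
  have "squares (T2 \<theta> K F \<eta> x s) = {Q. pos_def Q \<and> (?P1 Q \<and> L \<preceq> Q \<and> Q \<preceq> U)}"
    by (rule squares_pos_def) (simp add: T2_def c_def[symmetric] bounds)
  moreover have "geodesically_convex {Q. pos_def Q \<and> (?P1 Q \<and> L \<preceq> Q \<and> Q \<preceq> U)}"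
  proof (rule geodesically_convexI)
    fix A B :: "'a \<Rightarrow> 'a" and t :: real
    assume AB: "pos_def A" "pos_def B" and t: "0 \<le> t" "t \<le> 1"
      and A: "?P1 A \<and> L \<preceq> A \<and> A \<preceq> U" and B: "?P1 B \<and> L \<preceq> B \<and> B \<preceq> U"
    \<comment> \<open>The sign of \<open>k\<close> is forced by the mere existence of \<open>A\<close>, so that the value of
      \<open>xi_star\<close>, possibly the infimum of the empty set, does not matter.\<close>
    obtain v :: 'a where v: "v \<noteq> 0"
      using nonempty_Basis nonzero_Basis by blast
    have "0 < A v \<bullet> v"
      using AB v by (simp add: pos_def_def)
    also have "\<dots> \<le> U v \<bullet> v"
      using A by (simp add: loewner_le_iff(2)[OF pos_def_self_adjoint[OF AB(1)]])
    finally have "0 < k * (inv (hess F x) v \<bullet> v)"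
      by (simp add: U_def)
    then have "0 < k"
      using inv_hess_pos[OF assms(1-3,5,6) v] by (metis zero_less_mult_pos2)
    then have "0 \<le> L w \<bullet> w" for w
      using hess_conj_barrier_nonneg[OF assms(1-3,5,7,6), of w] by (simp add: L_def)
    then show "?P1 (geodesic_point A B t) \<and> L \<preceq> geodesic_point A B t \<and> geodesic_point A B t \<preceq> U"
      using A B geodesic_point_transport[OF AB t] geodesic_point_loewner_lower[OF AB t, of L]
        geodesic_point_loewner_upper[OF AB t, of U] by simp
  qed
  ultimately show "geodesically_convex (squares (T2 \<theta> K F \<eta> x s))"
    by simp
qed

end
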